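(* There is a fixed constant $\delta\geq 1/100$ and a set-multilinear polynomial $G_{n,n}$ in $\mathsf{VBP}$, in $\Theta(n^2)$ variables and of degree $\Theta(n)$, such that any $\sum\mathsf{smABP}$ computing $G_{n,n}$ requires total-width $\exp(\Omega(n^{\delta}))$.
   Context: A polynomial is set-multilinear with respect to a partition $(X_1,\ldots,X_m)$ of its variables if every monomial contains exactly one variable from each $X_i$. Given such a partition, a set-multilinear algebraic branching program (ABP) of depth $m$ is ordered with respect to a permutation $\sigma\in S_m$ if it is a layered directed acyclic graph with a start node (layer $0$) and an end node (layer $m$), all edges going from layer $\ell-1$ to layer $\ell$, and every edge from layer $\ell-1$ to layer $\ell$ labelled by a linear form in the variables of $X_{\sigma(\ell)}$; it computes the sum over all start-to-end paths of the product of the edge labels. Its width is the maximum number of nodes in a layer. A $\sum\mathsf{smABP}$ computing a polynomial $P$ that is set-multilinear with respect to the partition is an expression $\sum_{i=1}^t A_i=P$ where each $A_i$ is a set-multilinear ABP ordered with respect to some (possibly different) permutation $\sigma_i$; its total-width is the sum of the widths of the $A_i$. $\mathsf{VBP}$ is the class of polynomial families of polynomially bounded degree computable by polynomial-size algebraic branching programs (layered DAGs with edges labelled by linear polynomials, computing the sum over start-to-end paths of products of labels). *)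

theory Defs
  imports "HOL-Analysis.Analysis" "HOL-Library.Poly_Mapping" "HOL-Combinatorics.Permutations"
begin

type_synonym 'a mpoly = "(nat \<Rightarrow>\<^sub>0 nat) \<Rightarrow>\<^sub>0 'a"

definition Var :: "nat \<Rightarrow> 'a::zero_neq_one mpoly" where
  "Var i = Poly_Mapping.single (Poly_Mapping.single i 1) 1"

definition mono_deg :: "(nat \<Rightarrow>\<^sub>0 nat) \<Rightarrow> nat" where
  "mono_deg \<mu> = (\<Sum>v\<in>Poly_Mapping.keys \<mu>. Poly_Mapping.lookup \<mu> v)"

definition total_degree :: "'a::zero mpoly \<Rightarrow> nat" where
  "total_degree P = Max (insert 0 (mono_deg ` Poly_Mapping.keys P))"

definition vars :: "'a::zero mpoly \<Rightarrow> nat set" where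
  "vars P = \<Union> (Poly_Mapping.keys ` Poly_Mapping.keys P)"

definition is_var_partition :: "nat \<Rightarrow> (nat \<Rightarrow> nat set) \<Rightarrow> bool" where
  "is_var_partition m X \<longleftrightarrow> (\<forall>i<m. finite (X i)) \<and> (\<forall>i<m. \<forall>j<m. i \<noteq> j \<longrightarrow> X i \<inter> X j = {})"

definition set_multilinear :: "nat \<Rightarrow> (nat \<Rightarrow> nat set) \<Rightarrow> 'a::zero mpoly \<Rightarrow> bool" where
  "set_multilinear m X P \<longleftrightarrow>
     (\<forall>\<mu>\<in>Poly_Mapping.keys P. Poly_Mapping.keys \<mu> \<subseteq> (\<Union>i<m. X i) \<and> (\<forall>i<m. (\<Sum>v\<in>X i. Poly_Mapping.lookup \<mu> v) = 1))"

definition linear_form_in :: "nat set \<Rightarrow> 'a::zero mpoly \<Rightarrow> bool" where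
  "linear_form_in S L \<longleftrightarrow> (\<forall>\<mu>\<in>Poly_Mapping.keys L. \<exists>v\<in>S. \<mu> = Poly_Mapping.single v 1)"

definition linear_poly :: "'a::zero mpoly \<Rightarrow> bool" where
  "linear_poly L \<longleftrightarrow> (\<forall>\<mu>\<in>Poly_Mapping.keys L. mono_deg \<mu> \<le> 1)"

text \<open>Layered ABP of depth d: layer l has w l nodes numbered 0..<w l; L l j k is the label of the
  edge from node j of layer l-1 to node k of layer l (label 0 = no edge). Start node = node 0 of
  layer 0, end node = node 0 of layer d (layers 0 and d have exactly one node).\<close>
definition abp_paths :: "nat \<Rightarrow> (nat \<Rightarrow> nat) \<Rightarrow> (nat \<Rightarrow> nat) set" where
  "abp_paths d w = {p. (\<forall>l\<le>d. p l < w l) \<and> (\<forall>l>d. p l = 0)}"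

definition abp_eval :: "nat \<Rightarrow> (nat \<Rightarrow> nat) \<Rightarrow> (nat \<Rightarrow> nat \<Rightarrow> nat \<Rightarrow> 'a::comm_ring_1 mpoly) \<Rightarrow> 'a mpoly" where
  "abp_eval d w L = (\<Sum>p\<in>abp_paths d w. \<Prod>l\<in>{1..d}. L l (p (l - 1)) (p l))"

definition abp_width :: "nat \<Rightarrow> (nat \<Rightarrow> nat) \<Rightarrow> nat" where
  "abp_width d w = Max (w ` {..d})"

definition abp_size :: "nat \<Rightarrow> (nat \<Rightarrow> nat) \<Rightarrow> nat" where
  "abp_size d w = (\<Sum>l\<le>d. w l)"

definition is_abp :: "nat \<Rightarrow> (nat \<Rightarrow> nat) \<Rightarrow> (nat \<Rightarrow> nat \<Rightarrow> nat \<Rightarrow> 'a::comm_ring_1 mpoly) \<Rightarrow> bool" where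
  "is_abp d w L \<longleftrightarrow> w 0 = 1 \<and> w d = 1 \<and>
     (\<forall>l\<in>{1..d}. \<forall>j<w (l - 1). \<forall>k<w l. linear_poly (L l j k))"

definition is_smabp :: "nat \<Rightarrow> (nat \<Rightarrow> nat set) \<Rightarrow> (nat \<Rightarrow> nat) \<Rightarrow> (nat \<Rightarrow> nat)
     \<Rightarrow> (nat \<Rightarrow> nat \<Rightarrow> nat \<Rightarrow> 'a::comm_ring_1 mpoly) \<Rightarrow> bool" where
  "is_smabp m X \<sigma> w L \<longleftrightarrow> \<sigma> permutes {..<m} \<and> w 0 = 1 \<and> w m = 1 \<and>
     (\<forall>l\<in>{1..m}. \<forall>j<w (l - 1). \<forall>k<w l. linear_form_in (X (\<sigma> (l - 1))) (L l j k))"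

type_synonym 'a smabp = "(nat \<Rightarrow> nat) \<times> (nat \<Rightarrow> nat) \<times> (nat \<Rightarrow> nat \<Rightarrow> nat \<Rightarrow> 'a mpoly)"

definition sum_smabp_computes :: "nat \<Rightarrow> (nat \<Rightarrow> nat set) \<Rightarrow> 'a::comm_ring_1 smabp list \<Rightarrow> 'a mpoly \<Rightarrow> bool" where
  "sum_smabp_computes m X As P \<longleftrightarrow>
     (\<forall>(\<sigma>, w, L)\<in>set As. is_smabp m X \<sigma> w L) \<and> (\<Sum>(\<sigma>, w, L)\<leftarrow>As. abp_eval m w L) = P"

definition total_width :: "nat \<Rightarrow> 'a smabp list \<Rightarrow> nat" where
  "total_width m As = (\<Sum>(\<sigma>, w, L)\<leftarrow>As. abp_width m w)"

definition in_VBP :: "(nat \<Rightarrow> 'a::comm_ring_1 mpoly) \<Rightarrow> bool" where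
  "in_VBP f \<longleftrightarrow> (\<exists>c::nat. \<forall>n. total_degree (f n) \<le> c * n ^ c + c \<and>
      (\<exists>d w L. is_abp d w L \<and> abp_eval d w L = f n \<and> abp_size d w \<le> c * n ^ c + c))"

end

theory Submission
  imports Defs "HOL-Library.Function_Algebras"
begin

text \<open>
  Take \<open>b\<close> groups, each with \<open>k\<close> left and \<open>k\<close> right buckets. The factor of a group is a sum over the rotations
  \<open>a\<close> of \<open>{..<k}\<close>: a selector variable times the product, over the edges of the perfect matching
  \<open>u \<mapsto> u + a\<close>, of inner products of the two end buckets. Evaluating the selectors picks one matching per
  group, and whichever end of each edge is called a row and whichever a column, the coefficient matrix of
  what is left contains an identity matrix of size \<open>2\<close> to the number of edges.

  An ordered branching program of width \<open>w\<close>, cut into \<open>r\<close> intervals of \<open>b\<close> consecutive layers, has rank at most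
  \<open>w\<^sup>r\<close> times the product over the intervals of \<open>2\<close> to the smaller of the numbers of row and column buckets
  in it. For random rotations most edges join different intervals, and for random orientations the numbers of row
  and column buckets of an interval then differ by about \<open>\<surd>b\<close> in a constant fraction of the intervals, outside
  an event of probability \<open>2\<close> to the power \<open>- \<Omega>(b)\<close>. So either there are exponentially many programs, or one choice is
  unbalanced for all of them and comparing ranks gives \<open>w \<ge> 2\<close> to the power \<open>\<Omega>(\<surd>b)\<close>; with \<open>b\<close> of order
  \<open>\<surd>n\<close> this yields \<open>\<delta> = 1/4\<close>.
\<close>

section \<open>Random matchings and orientations are unbalanced\<close>

text \<open>A single fixed matching would not do: placing matched buckets in adjacent layers gives
  an ordered program of small width. The matching therefore has to be chosen after the orders of all
  programs are known, and the selectors pack k^b matchings into one polynomial with a small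
  branching program. Rotations suffice because any two positions of a group are joined by exactly
  one of the k rotations, so few rotations can keep many edges inside intervals; the b groups supply
  independent choices, hence a failure probability small enough for a union bound over the programs.
  Orientations are harder: an edge influences two intervals, so the imbalances are dependent and the
  edges have to be exposed interval by interval. As for the numbers, k = 16 b makes the degree 2bk +
  b = (32b + 1) b, that is, at most 33b intervals; a total imbalance of b h saves a factor 2^(bh/2)
  of rank, and sharing it among 33b intervals leaves width 2^(h/66). Only two colours per bucket
  enter the lower bound; the others adjust the number of variables.\<close>

text \<open>The factor 2m + 1 lets the induction close: passing to m + 1 multiplies the left side by
  4 (2m + 1) (2m + 3) / (m + 1)^2, which is at most 16 since (2m + 1) (2m + 3) <= (2m +
  2)^2.\<close>

lemma central_binomial_upper: "((2 * m) choose m) ^ 2 * (2 * m + 1) \<le> (16::nat) ^ m"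
proof (induction m)
  case (Suc m)
  define c where "c = (2 * m) choose m"
  define d where "d = (2 * Suc m) choose (Suc m)"
  have e: "Suc m * d = 2 * (2 * m + 1) * c"
  proof -
    have 1: "Suc m * d = (2 * Suc m) * ((2 * m + 1) choose m)"
      using Suc_times_binomial_eq[of "2*m+1" m] by (simp add: d_def mult.commute)
    have "Suc m * ((2 * m + 1) choose m) = (2 * m + 1) * c"
      using Suc_times_binomial_eq[of "2*m" m] binomial_symmetric[of m "2*m+1"]
      by (simp add: c_def mult.commute)
    then have "Suc m * (Suc m * d) = Suc m * (2 * (2 * m + 1) * c)"
      unfolding 1 by (metis (no_types, lifting) mult.assoc mult.left_commute)
    then show ?thesis by (simp only: mult_cancel1) simp
  qed
  have "(Suc m)\<^sup>2 * (d\<^sup>2 * (2 * m + 3)) = (Suc m * d)\<^sup>2 * (2 * m + 3)"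
    by (simp only: power_mult_distrib mult.assoc)
  also have "\<dots> = 4 * (2 * m + 1) * (2 * m + 3) * (c\<^sup>2 * (2 * m + 1))"
    unfolding e by (simp add: power2_eq_square algebra_simps)
  also have "\<dots> \<le> (16 * (Suc m)\<^sup>2) * 16 ^ m"
  proof (rule mult_mono)
    show "4 * (2 * m + 1) * (2 * m + 3) \<le> 16 * (Suc m)\<^sup>2"
      by (simp add: power2_eq_square algebra_simps)
  qed (use Suc in \<open>auto simp: c_def\<close>)
  finally have "(Suc m)\<^sup>2 * (d\<^sup>2 * (2 * m + 3)) \<le> (Suc m)\<^sup>2 * 16 ^ Suc m" by (simp add: mult_ac)
  then have "d\<^sup>2 * (2 * m + 3) \<le> 16 ^ Suc m" by (simp only: mult_le_cancel1) auto
  moreover have "2 * Suc m + 1 = 2 * m + 3" by simp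
  ultimately show ?case by (simp only: d_def)
qed simp

text \<open>The middle coefficient dominates; odd f is reduced to f - 1 by Pascal's rule at the cost
  of a factor 2. Squaring first keeps the argument in the natural numbers.\<close>

lemma binomial_sqrt_upper: "real (f choose i) * sqrt (real f) \<le> 2 ^ f"
proof -
  define m where "m = f div 2"
  have le: "(f choose i)\<^sup>2 * f \<le> 4 ^ f"
  proof (cases "even f")
    case True
    then have f: "f = 2 * m" by (simp add: m_def)
    have "(f choose i)\<^sup>2 * f \<le> ((2 * m) choose m)\<^sup>2 * (2 * m + 1)"
      unfolding f using binomial_maximum'[of m i] by (intro mult_mono power_mono) auto
    also have "\<dots> \<le> 4 ^ f"
      using central_binomial_upper[of m] by (simp add: f power_mult)
    finally show ?thesis .
  next
    case False
    then have f: "f = Suc (2 * m)" by (simp add: m_def)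
    have "(f choose i) \<le> 2 * ((2 * m) choose m)"
    proof (cases i)
      case (Suc j)
      then show ?thesis using binomial_maximum'[of m i] binomial_maximum'[of m j] by (simp add: f)
    qed (use binomial_maximum'[of m 0] in \<open>simp add: f\<close>)
    then have "(f choose i)\<^sup>2 * f \<le> (2 * ((2 * m) choose m))\<^sup>2 * (2 * m + 1)"
      by (intro mult_mono power_mono) (auto simp: f)
    also have "\<dots> = 4 * (((2 * m) choose m)\<^sup>2 * (2 * m + 1))"
      by (simp add: power_mult_distrib)
    also have "\<dots> \<le> 4 * 16 ^ m"
      using central_binomial_upper[of m] by simp
    also have "\<dots> \<le> 4 ^ f"
      by (simp add: f power_mult)
    finally show ?thesis .
  qed
  have "(real (f choose i) * sqrt (real f))\<^sup>2 = real ((f choose i)\<^sup>2 * f)"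
    by (simp add: power_mult_distrib)
  also have "\<dots> \<le> real (4 ^ f)" using le by (simp only: of_nat_le_iff)
  also have "\<dots> = (2 ^ f)\<^sup>2" by (simp add: power2_eq_square power_mult_distrib[symmetric])
  finally show ?thesis by (rule power2_le_imp_le) simp
qed

text \<open>Littlewood-Offord for coefficients 1 and -1. Flipping \<open>\<eta>\<close> where the
  coefficient is -1 turns the sum into 2 |\<open>\<Delta> \<eta>\<close>| - f, so the window meets
  at most 2h levels of the subset lattice, each with at most 2^f / sqrt f sets. Since sqrt f >= 32
  h, this is at most 2^f / 16. The shift \<open>d\<close> stands for the signs fixed outside
  \<open>F\<close>.\<close>

lemma sign_sum_small_card:
  fixes c :: "'e \<Rightarrow> int" and h :: nat
  assumes F: "finite F" and c: "\<And>e. e \<in> F \<Longrightarrow> c e = 1 \<or> c e = -1" and h: "1024 * h\<^sup>2 \<le> card F"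
  shows "16 * card {\<eta>\<in>Pow F. \<bar>d + (\<Sum>e\<in>F. c e * (if e \<in> \<eta> then 1 else -1))\<bar> < int h} \<le> 2 ^ card F"
proof (cases "h = 0")
  case False
  define f where "f = card F"
  define N where "N = {e\<in>F. c e = -1}"
  define A where "A = {\<eta>\<in>Pow F. \<bar>d + (\<Sum>e\<in>F. c e * (if e \<in> \<eta> then 1 else -1))\<bar> < int h}"
  define I where "I = {i::nat. \<bar>d + 2 * int i - int f\<bar> < int h}"
  define \<Delta> where "\<Delta> \<eta> = (\<eta> - N) \<union> (N - \<eta>)" for \<eta>
  have cardN: "(\<Sum>e\<in>F. c e * (if e \<in> \<eta> then 1 else -1)) = 2 * int (card (\<Delta> \<eta>)) - int f" if "\<eta> \<subseteq> F" for \<eta>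
  proof -
    have "(\<Sum>e\<in>F. c e * (if e \<in> \<eta> then 1 else -1)) = (\<Sum>e\<in>F. 2 * (if e \<in> \<Delta> \<eta> then 1 else 0) - 1)"
      using c by (intro sum.cong) (auto simp: \<Delta>_def N_def)
    also have "\<dots> = 2 * (\<Sum>e\<in>F. if e \<in> \<Delta> \<eta> then 1 else 0) - int f"
      by (simp add: sum_subtractf sum_distrib_left f_def)
    also have "(\<Sum>e\<in>F. if e \<in> \<Delta> \<eta> then 1 else 0) = int (card (\<Delta> \<eta>))"
    proof -
      have "F \<inter> \<Delta> \<eta> = \<Delta> \<eta>" using that by (auto simp: \<Delta>_def N_def)
      then show ?thesis using F by (simp add: sum.If_cases)
    qed
    finally show ?thesis .
  qed
  have fin: "finite I"
  proof (rule finite_subset)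
    show "I \<subseteq> {..nat (int h + int f + \<bar>d\<bar>)}" by (auto simp: I_def)
  qed simp
  have cardI: "card I \<le> 2 * h"
  proof -
    have "card I \<le> card {- int h<..<int h}"
      by (rule card_inj_on_le[where f = "\<lambda>i. d + 2 * int i - int f"]) (auto simp: I_def inj_on_def)
    then show ?thesis by simp
  qed
  have "\<Delta> ` A \<subseteq> (\<Union>i\<in>I. {B. B \<subseteq> F \<and> card B = i})"
    using cardN by (auto simp: A_def I_def) (auto simp: \<Delta>_def N_def algebra_simps)
  moreover have "inj_on \<Delta> A" by (auto simp: inj_on_def \<Delta>_def)
  moreover have finU: "finite (\<Union>i\<in>I. {B. B \<subseteq> F \<and> card B = i})"
    using fin F by auto
  ultimately have "card A \<le> card (\<Union>i\<in>I. {B. B \<subseteq> F \<and> card B = i})"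
    by (metis card_inj_on_le)
  also have "\<dots> \<le> (\<Sum>i\<in>I. f choose i)"
    using card_UN_le[OF fin, of "\<lambda>i. {B. B \<subseteq> F \<and> card B = i}"] by (simp add: n_subsets[OF F] f_def)
  finally have "real (card A) \<le> (\<Sum>i\<in>I. real (f choose i))"
    by (metis of_nat_le_iff of_nat_sum)
  then have "real (card A) * sqrt (real f) \<le> (\<Sum>i\<in>I. real (f choose i) * sqrt (real f))"
    by (simp add: sum_distrib_right[symmetric] mult_right_mono)
  also have "\<dots> \<le> (\<Sum>i\<in>I. 2 ^ f)"
    by (intro sum_mono binomial_sqrt_upper)
  also have "\<dots> \<le> real (2 * h) * 2 ^ f"
    using cardI by (simp add: mult_right_mono)
  finally have 1: "real (card A) * sqrt (real f) \<le> real (2 * h) * 2 ^ f" .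
  have "real (32 * h) = sqrt (real (1024 * h\<^sup>2))"
    by (simp add: real_sqrt_mult)
  also have "\<dots> \<le> sqrt (real f)" using h by (simp only: f_def real_sqrt_le_iff of_nat_le_iff)
  finally have "real (card A) * real (32 * h) \<le> real (card A) * sqrt (real f)"
    by (intro mult_left_mono) auto
  with 1 have "(16 * real (card A)) * (2 * real h) \<le> 2 ^ f * (2 * real h)" by (simp add: mult_ac)
  then have "16 * real (card A) \<le> 2 ^ f" using False by simp
  then have "real (16 * card A) \<le> real (2 ^ f)" by simp
  then show ?thesis unfolding A_def f_def by (simp only: of_nat_le_iff)
qed simp

lemma sum_Pow_Un:
  assumes "A \<inter> B = {}"
  shows "(\<Sum>\<epsilon>\<in>Pow (A \<union> B). f \<epsilon>) = (\<Sum>x\<in>Pow A. \<Sum>y\<in>Pow B. f (x \<union> y))"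
proof -
  have "bij_betw (\<lambda>(x, y). x \<union> y) (Pow A \<times> Pow B) (Pow (A \<union> B))"
    by (rule bij_betw_byWitness[where f' = "\<lambda>z. (z \<inter> A, z \<inter> B)"]) (use assms in auto)
  from sum.reindex_bij_betw[OF this, of f] show ?thesis
    by (simp add: sum.cartesian_product case_prod_unfold)
qed

section \<open>Unbalanced orientations\<close>

text \<open>A substitute for independence. Exposing the blocks in order, each block of
  \<open>J\<close> multiplies the mean of 16^(number of bad blocks) by at most 1 + 16/16 = 2,
  whatever the earlier blocks were; \<open>dep\<close> says that later blocks cannot change a
  verdict.\<close>

lemma sequential_exp_moment:
  fixes E :: "nat \<Rightarrow> 'e set" and Bad :: "nat \<Rightarrow> 'e set \<Rightarrow> bool"
  assumes fin: "\<And>j. j < N \<Longrightarrow> finite (E j)"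
    and disj: "\<And>i j. i < j \<Longrightarrow> j < N \<Longrightarrow> E i \<inter> E j = {}"
    and dep: "\<And>i j \<epsilon> \<eta>. i < j \<Longrightarrow> j < N \<Longrightarrow> i \<in> J \<Longrightarrow> \<eta> \<subseteq> E j \<Longrightarrow> Bad i (\<epsilon> \<union> \<eta>) = Bad i \<epsilon>"
    and anti: "\<And>j \<epsilon>. j < N \<Longrightarrow> j \<in> J \<Longrightarrow> \<epsilon> \<subseteq> (\<Union>i<j. E i) \<Longrightarrow> 16 * card {\<eta>\<in>Pow (E j). Bad j (\<epsilon> \<union> \<eta>)} \<le> 2 ^ card (E j)"
  shows "(\<Sum>\<epsilon>\<in>Pow (\<Union>i<N. E i). (16::nat) ^ card {j. j < N \<and> j \<in> J \<and> Bad j \<epsilon>})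
    \<le> 2 ^ card (\<Union>i<N. E i) * 2 ^ card (J \<inter> {..<N})"
  using assms
proof (induction N)
  case (Suc N)
  let ?F = "\<Union>i<N. E i"
  have IH: "(\<Sum>\<epsilon>\<in>Pow ?F. (16::nat) ^ card {j. j < N \<and> j \<in> J \<and> Bad j \<epsilon>})
    \<le> 2 ^ card ?F * 2 ^ card (J \<inter> {..<N})"
  proof (rule Suc.IH)
    show "16 * card {\<eta>\<in>Pow (E j). Bad j (\<epsilon> \<union> \<eta>)} \<le> 2 ^ card (E j)"
      if "j < N" "j \<in> J" "\<epsilon> \<subseteq> (\<Union>i<j. E i)" for j \<epsilon> using Suc.prems(4) that by simp
  qed (use Suc.prems(1-3) in auto)
  have U: "(\<Union>i<Suc N. E i) = ?F \<union> E N" by (auto simp: less_Suc_eq)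
  have d: "?F \<inter> E N = {}" using Suc.prems(2)[of _ N] by auto
  have finN: "finite (E N)" and finF: "finite ?F" using Suc.prems(1) by auto
  have cU: "card (?F \<union> E N) = card ?F + card (E N)" by (rule card_Un_disjoint[OF finF finN d])
  define m where "m = (if N \<in> J then 2 else 1::nat)"
  have cJ: "(2::nat) ^ card (J \<inter> {..<Suc N}) = m * 2 ^ card (J \<inter> {..<N})"
    by (auto simp: m_def lessThan_Suc)
  have step: "(\<Sum>y\<in>Pow (E N). (16::nat) ^ card {j. j < Suc N \<and> j \<in> J \<and> Bad j (x \<union> y)})
      \<le> 16 ^ card {j. j < N \<and> j \<in> J \<and> Bad j x} * (m * 2 ^ card (E N))" if x: "x \<subseteq> ?F" for x
  proof -
    have eq: "(16::nat) ^ card {j. j < Suc N \<and> j \<in> J \<and> Bad j (x \<union> y)}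
      = 16 ^ card {j. j < N \<and> j \<in> J \<and> Bad j x} * (if N \<in> J \<and> Bad N (x \<union> y) then 16 else 1)" if y: "y \<in> Pow (E N)" for y
    proof -
      have "{j. j < Suc N \<and> j \<in> J \<and> Bad j (x \<union> y)} = {j. j < N \<and> j \<in> J \<and> Bad j x} \<union> {j. j = N \<and> N \<in> J \<and> Bad N (x \<union> y)}"
        using Suc.prems(3)[of _ N y x] y by (auto simp: less_Suc_eq)
      moreover have "card ({j. j < N \<and> j \<in> J \<and> Bad j x} \<union> {j. j = N \<and> N \<in> J \<and> Bad N (x \<union> y)})
        = card {j. j < N \<and> j \<in> J \<and> Bad j x} + card {j. j = N \<and> N \<in> J \<and> Bad N (x \<union> y)}"
        by (rule card_Un_disjoint) auto
      ultimately show ?thesis by (auto simp: power_add)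
    qed
    have "(\<Sum>y\<in>Pow (E N). if N \<in> J \<and> Bad N (x \<union> y) then 16 else 1::nat) \<le> m * 2 ^ card (E N)"
    proof (cases "N \<in> J")
      case True
      have "(\<Sum>y\<in>Pow (E N). if N \<in> J \<and> Bad N (x \<union> y) then 16 else 1::nat)
        \<le> (\<Sum>y\<in>Pow (E N). (if Bad N (x \<union> y) then 16 else 0) + 1::nat)" by (intro sum_mono) auto
      also have "\<dots> = 16 * card {\<eta>\<in>Pow (E N). Bad N (x \<union> \<eta>)} + 2 ^ card (E N)"
        unfolding sum.distrib
        by (subst sum.inter_filter[symmetric]) (use finN in \<open>simp_all add: card_Pow\<close>)
      also have "\<dots> \<le> m * 2 ^ card (E N)" using Suc.prems(4)[of N x] x True by (simp add: m_def)
      finally show ?thesis .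
    qed (simp add: m_def card_Pow finN)
    then show ?thesis by (simp add: eq sum_distrib_left[symmetric])
  qed
  have "(\<Sum>\<epsilon>\<in>Pow (\<Union>i<Suc N. E i). (16::nat) ^ card {j. j < Suc N \<and> j \<in> J \<and> Bad j \<epsilon>})
      = (\<Sum>x\<in>Pow ?F. \<Sum>y\<in>Pow (E N). (16::nat) ^ card {j. j < Suc N \<and> j \<in> J \<and> Bad j (x \<union> y)})"
    unfolding U by (rule sum_Pow_Un[OF d])
  also have "\<dots> \<le> (\<Sum>x\<in>Pow ?F. 16 ^ card {j. j < N \<and> j \<in> J \<and> Bad j x} * (m * 2 ^ card (E N)))"
    by (intro sum_mono step) auto
  also have "\<dots> \<le> (2 ^ card ?F * 2 ^ card (J \<inter> {..<N})) * (m * 2 ^ card (E N))"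
    unfolding sum_distrib_right[symmetric] using IH by (rule mult_right_mono) simp
  also have "\<dots> = 2 ^ card (\<Union>i<Suc N. E i) * 2 ^ card (J \<inter> {..<Suc N})"
    unfolding U cU cJ by (simp add: power_add)
  finally show ?case .
qed simp

text \<open>\<open>\<epsilon>\<close> is an orientation: an edge in it has its row end in interval
  \<open>x e\<close> and its column end in \<open>y e\<close>, any other edge the reverse. The value
  is rows minus columns in interval \<open>j\<close>; an edge with both ends there cancels.\<close>

definition imbalance :: "'e set \<Rightarrow> ('e \<Rightarrow> nat) \<Rightarrow> ('e \<Rightarrow> nat) \<Rightarrow> 'e set \<Rightarrow> nat \<Rightarrow> int" where
  "imbalance E x y \<epsilon> j = (\<Sum>e\<in>E. (of_bool (x e = j) - of_bool (y e = j)) * (if e \<in> \<epsilon> then 1 else -1))"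

text \<open>No interval is charged more than b of the 4 b^2 crossing edges, so at least 2b
  intervals, those in \<open>J\<close>, are charged many. If the imbalances sum to less than b h,
  fewer than b of them have imbalance at least h, so at least half of \<open>J\<close> is bad.
  Markov's inequality for 16^(number of bad intervals) bounds the probability of this by 2^|J| /
  4^|J|, hence by 2^(-2b).\<close>

lemma random_signs:
  fixes x y :: "'e \<Rightarrow> nat"
  assumes E: "finite E" and x: "\<And>e. e \<in> E \<Longrightarrow> x e < r" and y: "\<And>e. e \<in> E \<Longrightarrow> y e < r"
    and fib: "\<And>j. card {e\<in>E. x e = j} + card {e\<in>E. y e = j} \<le> b"
    and cross: "4 * b\<^sup>2 \<le> card {e\<in>E. x e \<noteq> y e}" and r: "r \<le> 33 * b"
    and b: "b = 32768 * h\<^sup>2" and h: "h > 0"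
  shows "card {\<epsilon>\<in>Pow E. (\<Sum>j<r. \<bar>imbalance E x y \<epsilon> j\<bar>) < int (b * h)} * 2 ^ (2 * b) \<le> 2 ^ card E"
proof -
  \<comment> \<open>Each crossing edge is charged to its smaller interval, so that \<open>imbalance \<dots> j\<close> depends only on the edges
    charged to intervals up to \<open>j\<close>; the other edges go to the dummy index \<open>r\<close>.\<close>
  define lo where "lo e = (if x e \<noteq> y e then min (x e) (y e) else r)" for e
  define Ej where "Ej j = {e\<in>E. lo e = j}" for j
  define c where "c j e = (of_bool (x e = j) - of_bool (y e = j) :: int)" for j e
  define J where "J = {j. j < r \<and> 1024 * h\<^sup>2 \<le> card (Ej j)}"
  define Bad where "Bad j \<epsilon> \<longleftrightarrow> \<bar>imbalance E x y \<epsilon> j\<bar> < int h" for j \<epsilon>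
  define bc where "bc \<epsilon> = card {j. j < Suc r \<and> j \<in> J \<and> Bad j \<epsilon>}" for \<epsilon>
  have imb: "imbalance E x y \<epsilon> j = (\<Sum>e\<in>E. c j e * (if e \<in> \<epsilon> then 1 else -1))" for \<epsilon> j
    by (simp add: imbalance_def c_def)
  have finEj: "finite (Ej j)" for j using E by (simp add: Ej_def)
  have finJ: "finite J" by (simp add: J_def)
  have loE: "lo e < Suc r" if "e \<in> E" for e using x[OF that] y[OF that] by (auto simp: lo_def)
  have UE: "(\<Union>i<Suc r. Ej i) = E"
    using loE by (auto simp: Ej_def)
  have JI: "J \<inter> {..<Suc r} = J" by (auto simp: J_def)
  have moment: "(\<Sum>\<epsilon>\<in>Pow (\<Union>i<Suc r. Ej i). (16::nat) ^ card {j. j < Suc r \<and> j \<in> J \<and> Bad j \<epsilon>})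
    \<le> 2 ^ card (\<Union>i<Suc r. Ej i) * 2 ^ card (J \<inter> {..<Suc r})"
  proof (rule sequential_exp_moment)
    show "Ej i \<inter> Ej j = {}" if "i < j" for i j using that by (auto simp: Ej_def)
    show "Bad i (\<epsilon> \<union> \<eta>) = Bad i \<epsilon>" if "i < j" "i \<in> J" "\<eta> \<subseteq> Ej j" for i j \<epsilon> \<eta>
    proof -
      \<comment> \<open>A crossing edge charged to \<open>j\<close> > \<open>i\<close> has both ends
        beyond \<open>i\<close>; a non-crossing one has equal ends, so its two indicators
        cancel.\<close>
      have "c i e = 0" if "e \<in> \<eta>" for e
        using that \<open>\<eta> \<subseteq> Ej j\<close> \<open>i < j\<close> by (auto simp: Ej_def c_def lo_def split: if_splits)
      then have "imbalance E x y (\<epsilon> \<union> \<eta>) i = imbalance E x y \<epsilon> i"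
        unfolding imb by (intro sum.cong) auto
      then show ?thesis by (simp add: Bad_def)
    qed
    show "16 * card {\<eta>\<in>Pow (Ej j). Bad j (\<epsilon> \<union> \<eta>)} \<le> 2 ^ card (Ej j)"
      if "j \<in> J" "\<epsilon> \<subseteq> (\<Union>i<j. Ej i)" for j \<epsilon>
    proof -
      define d where "d = (\<Sum>e\<in>E - Ej j. c j e * (if e \<in> \<epsilon> then 1 else -1))"
      have nin: "e \<notin> \<epsilon>" if "e \<in> Ej j" for e using that \<open>\<epsilon> \<subseteq> (\<Union>i<j. Ej i)\<close> by (auto simp: Ej_def)
      have eq: "imbalance E x y (\<epsilon> \<union> \<eta>) j = d + (\<Sum>e\<in>Ej j. c j e * (if e \<in> \<eta> then 1 else -1))"
        if "\<eta> \<subseteq> Ej j" for \<eta>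
      proof -
        have "imbalance E x y (\<epsilon> \<union> \<eta>) j = (\<Sum>e\<in>E - Ej j. c j e * (if e \<in> \<epsilon> \<union> \<eta> then 1 else -1))
          + (\<Sum>e\<in>Ej j. c j e * (if e \<in> \<epsilon> \<union> \<eta> then 1 else -1))"
          unfolding imb by (rule sum.subset_diff) (use E in \<open>auto simp: Ej_def\<close>)
        also have "(\<Sum>e\<in>E - Ej j. c j e * (if e \<in> \<epsilon> \<union> \<eta> then 1 else -1)) = d"
          unfolding d_def using that by (intro sum.cong) auto
        also have "(\<Sum>e\<in>Ej j. c j e * (if e \<in> \<epsilon> \<union> \<eta> then 1 else -1)) = (\<Sum>e\<in>Ej j. c j e * (if e \<in> \<eta> then 1 else -1))"
          using nin by (intro sum.cong) auto
        finally show ?thesis .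
      qed
      have "16 * card {\<eta>\<in>Pow (Ej j). \<bar>d + (\<Sum>e\<in>Ej j. c j e * (if e \<in> \<eta> then 1 else -1))\<bar> < int h} \<le> 2 ^ card (Ej j)"
      proof (rule sign_sum_small_card[OF finEj])
        show "c j e = 1 \<or> c j e = -1" if "e \<in> Ej j" for e
          using that \<open>j \<in> J\<close> by (auto simp: Ej_def J_def c_def lo_def min_def split: if_splits)
      qed (use \<open>j \<in> J\<close> in \<open>simp add: J_def\<close>)
      moreover have "{\<eta>\<in>Pow (Ej j). Bad j (\<epsilon> \<union> \<eta>)}
        = {\<eta>\<in>Pow (Ej j). \<bar>d + (\<Sum>e\<in>Ej j. c j e * (if e \<in> \<eta> then 1 else -1))\<bar> < int h}"
        using eq by (auto simp: Bad_def)
      ultimately show ?thesis by simp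
    qed
  qed (use finEj in auto)
  have cardEj: "card (Ej j) \<le> b" if "j < r" for j
  proof -
    have "card (Ej j) \<le> card ({e\<in>E. x e = j} \<union> {e\<in>E. y e = j})"
      using E that by (intro card_mono) (auto simp: Ej_def lo_def min_def split: if_splits)
    also have "\<dots> \<le> card {e\<in>E. x e = j} + card {e\<in>E. y e = j}" by (rule card_Un_le)
    also have "\<dots> \<le> b" by (rule fib)
    finally show ?thesis .
  qed
  have J2b: "2 * b \<le> card J"
  proof -
    have "{e\<in>E. x e \<noteq> y e} = (\<Union>j<r. Ej j)"
      using x y by (auto simp: Ej_def lo_def min_def split: if_splits)
    then have "4 * b\<^sup>2 \<le> card (\<Union>j<r. Ej j)" using cross by simp
    also have "\<dots> \<le> (\<Sum>j<r. card (Ej j))" by (rule card_UN_le) simp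
    also have "\<dots> \<le> (\<Sum>j<r. (if j \<in> J then b else 0) + 1024 * h\<^sup>2)"
      using cardEj by (intro sum_mono) (auto simp: J_def intro: trans_le_add1)
    also have "\<dots> = card J * b + r * (1024 * h\<^sup>2)"
    proof -
      have "{..<r} \<inter> J = J" by (auto simp: J_def)
      then show ?thesis by (simp add: sum.distrib sum.If_cases)
    qed
    also have "\<dots> \<le> card J * b + 33 * b * (1024 * h\<^sup>2)" using r by simp
    also have "\<dots> \<le> card J * b + 2 * b\<^sup>2"
      by (simp add: b power2_eq_square)
    finally have "2 * b * b \<le> card J * b" by (simp add: power2_eq_square)
    moreover have "b > 0" using b h by simp
    ultimately show ?thesis by simp
  qed
  define S where "S = {\<epsilon>\<in>Pow E. (\<Sum>j<r. \<bar>imbalance E x y \<epsilon> j\<bar>) < int (b * h)}"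
  have bad: "card J \<le> 2 * bc \<epsilon>" if "\<epsilon> \<in> S" for \<epsilon>
  proof (rule ccontr)
    assume "\<not> card J \<le> 2 * bc \<epsilon>"
    define Gd where "Gd = {j\<in>J. \<not> Bad j \<epsilon>}"
    have "J = Gd \<union> {j. j < Suc r \<and> j \<in> J \<and> Bad j \<epsilon>}" by (auto simp: Gd_def J_def)
    then have "card J \<le> card Gd + bc \<epsilon>" unfolding bc_def by (metis card_Un_le)
    then have "b \<le> card Gd" using \<open>\<not> card J \<le> 2 * bc \<epsilon>\<close> J2b by linarith
    then have "int (b * h) \<le> int (card Gd) * int h" by (simp add: mult_right_mono)
    also have "\<dots> = (\<Sum>j\<in>Gd. int h)" by simp
    also have "\<dots> \<le> (\<Sum>j\<in>Gd. \<bar>imbalance E x y \<epsilon> j\<bar>)"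
      by (intro sum_mono) (auto simp: Gd_def Bad_def)
    also have "\<dots> \<le> (\<Sum>j<r. \<bar>imbalance E x y \<epsilon> j\<bar>)"
      by (intro sum_mono2) (auto simp: Gd_def J_def)
    finally show False using that by (simp add: S_def)
  qed
  have finS: "finite S" using E by (simp add: S_def)
  have "card S * 4 ^ card J = (\<Sum>\<epsilon>\<in>S. 4 ^ card J)" by simp
  also have "\<dots> \<le> (\<Sum>\<epsilon>\<in>S. 16 ^ bc \<epsilon>)"
  proof (intro sum_mono)
    fix \<epsilon> assume "\<epsilon> \<in> S"
    then have "(4::nat) ^ card J \<le> 4 ^ (2 * bc \<epsilon>)" using bad by (intro power_increasing) auto
    then show "(4::nat) ^ card J \<le> 16 ^ bc \<epsilon>" by (simp add: power_mult)
  qed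
  also have "\<dots> \<le> (\<Sum>\<epsilon>\<in>Pow E. 16 ^ bc \<epsilon>)"
    by (intro sum_mono2) (use E in \<open>auto simp: S_def\<close>)
  also have "\<dots> \<le> 2 ^ card E * 2 ^ card J"
    using moment unfolding UE JI bc_def .
  finally have "(card S * 2 ^ card J) * 2 ^ card J \<le> 2 ^ card E * 2 ^ card J"
    by (simp add: mult.assoc power_mult_distrib[symmetric])
  then have "card S * 2 ^ card J \<le> 2 ^ card E" by simp
  moreover have "card S * 2 ^ (2 * b) \<le> card S * 2 ^ card J"
    using J2b by (intro mult_left_mono power_increasing) auto
  ultimately show ?thesis unfolding S_def by linarith
qed

section \<open>Random rotations\<close>

lemma rotation_inverse:
  fixes a u k :: nat
  assumes "u < k"
  shows "((a + u) mod k + (k - a mod k)) mod k = u"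
proof -
  have "((a + u) mod k + (k - a mod k)) mod k = (a mod k + (k - a mod k) + u) mod k"
    by (metis (no_types, lifting) add.assoc add.commute mod_add_left_eq)
  also have "a mod k + (k - a mod k) = k" using assms by (simp add: less_imp_le)
  finally show ?thesis using assms by simp
qed

lemma bij_betw_rotation: "bij_betw (\<lambda>u. (a + u) mod k) {..<k} {..<k::nat}"
proof -
  have "inj_on (\<lambda>u. (a + u) mod k) {..<k}"
    by (rule inj_on_inverseI[where g = "\<lambda>v. (v + (k - a mod k)) mod k"]) (simp only: rotation_inverse lessThan_iff)
  moreover have "(\<lambda>u. (a + u) mod k) ` {..<k} \<subseteq> {..<k}" by auto
  ultimately show ?thesis by (metis bij_betw_def endo_inj_surj finite_lessThan)
qed

text \<open>Since \<open>a + u\<close> is symmetric, this counts positions for a fixed rotation as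
  well as rotations for a fixed position; both readings are used.\<close>

lemma card_rotation_fibre:
  fixes a k :: nat
  shows "card {u. u < k \<and> P ((a + u) mod k)} = card {v. v < k \<and> P v}"
proof (rule bij_betw_same_card)
  have b: "bij_betw (\<lambda>u. (a + u) mod k) {..<k} {..<k}" by (rule bij_betw_rotation)
  have "bij_betw (\<lambda>u. (a + u) mod k) {u \<in> {..<k}. P ((a + u) mod k)} {v \<in> {..<k}. P v}"
  proof (rule bij_betw_imageI)
    show "inj_on (\<lambda>u. (a + u) mod k) {u \<in> {..<k}. P ((a + u) mod k)}"
      using bij_betw_imp_inj_on[OF b] by (rule inj_on_subset) auto
    have "(\<lambda>u. (a + u) mod k) ` {u \<in> {..<k}. P ((a + u) mod k)} = {v \<in> (\<lambda>u. (a + u) mod k) ` {..<k}. P v}"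
      by blast
    then show "(\<lambda>u. (a + u) mod k) ` {u \<in> {..<k}. P ((a + u) mod k)} = {v \<in> {..<k}. P v}"
      unfolding bij_betw_imp_surj_on[OF b] .
  qed
  then show "bij_betw (\<lambda>u. (a + u) mod k) {u. u < k \<and> P ((a + u) mod k)} {v. v < k \<and> P v}"
    by simp
qed

text \<open>For a fixed left bucket at most b rotations keep its edge inside one interval, so the
  mean number of such edges per rotation is at most b = k/16, and at most 1/8 of the rotations of a
  group keep more than k/2. Groups being independent, the mean of 8^(number of bad groups) is at
  most 2^q. Fewer than qk/4 crossing edges force at least q/2 bad groups, which has probability at
  most 4^q' / 8^q'.\<close>

lemma random_matchings:
  fixes bu bv :: "nat \<Rightarrow> nat \<Rightarrow> nat"
  assumes k: "k = 16 * b" and b: "b > 0" and q: "q = 2 * q'"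
    and fib: "\<And>g j. g < q \<Longrightarrow> card {v. v < k \<and> bv g v = j} \<le> b"
  shows "card {a \<in> PiE {..<q} (\<lambda>_. {..<k}).
    4 * card {(g, u) \<in> {..<q} \<times> {..<k}. bu g u \<noteq> bv g ((u + a g) mod k)} < q * k} * 2 ^ q' \<le> k ^ q"
proof -
  define Bad where "Bad g a \<longleftrightarrow> k < 2 * card {u. u < k \<and> bv g ((u + a) mod k) = bu g u}" for g a
  have few: "8 * card {a. a < k \<and> Bad g a} \<le> k" if g: "g < q" for g
  proof -
    have "card {a. a < k \<and> Bad g a} * k = (\<Sum>a\<in>{a. a < k \<and> Bad g a}. k)" by simp
    also have "\<dots> \<le> (\<Sum>a\<in>{a. a < k \<and> Bad g a}. 2 * card {u. u < k \<and> bv g ((u + a) mod k) = bu g u})"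
      by (intro sum_mono) (auto simp: Bad_def)
    also have "\<dots> \<le> (\<Sum>a<k. 2 * card {u. u < k \<and> bv g ((u + a) mod k) = bu g u})"
      by (intro sum_mono2) auto
    also have "\<dots> = 2 * (\<Sum>a<k. \<Sum>u<k. of_bool (bv g ((u + a) mod k) = bu g u))"
      by (simp add: sum_distrib_left of_bool_def sum.If_cases lessThan_def Int_def)
    also have "\<dots> = 2 * (\<Sum>u<k. \<Sum>a<k. of_bool (bv g ((u + a) mod k) = bu g u))"
      by (subst sum.swap) simp
    also have "\<dots> = 2 * (\<Sum>u<k. card {a. a < k \<and> bv g ((u + a) mod k) = bu g u})"
      by (simp add: of_bool_def sum.If_cases lessThan_def Int_def)
    also have "\<dots> = 2 * (\<Sum>u<k. card {v. v < k \<and> bv g v = bu g u})"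
      by (subst card_rotation_fibre) simp
    also have "\<dots> \<le> 2 * (\<Sum>u<k. b)"
      using fib[OF g] by (intro mult_left_mono sum_mono) auto
    finally have "card {a. a < k \<and> Bad g a} * k \<le> (2 * b) * k" by simp
    moreover have "k > 0" using k b by simp
    ultimately show ?thesis using k by simp
  qed
  define A where "A = PiE {..<q} (\<lambda>_. {..<k})"
  define S where "S = {a \<in> A. 4 * card {(g, u) \<in> {..<q} \<times> {..<k}. bu g u \<noteq> bv g ((u + a g) mod k)} < q * k}"
  have finA: "finite A" by (simp add: A_def finite_PiE)
  have many: "q' \<le> card {g. g < q \<and> Bad g (a g)}" if "a \<in> S" for a
  proof (rule ccontr)
    assume lt: "\<not> q' \<le> card {g. g < q \<and> Bad g (a g)}"
    define Gd where "Gd = {g. g < q \<and> \<not> Bad g (a g)}"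
    have "{..<q} = Gd \<union> {g. g < q \<and> Bad g (a g)}" by (auto simp: Gd_def)
    then have "q \<le> card Gd + card {g. g < q \<and> Bad g (a g)}" by (metis card_Un_le card_lessThan)
    then have "q' \<le> card Gd" using lt q by linarith
    then have "q * k \<le> 2 * (card Gd * k)" using q by simp
    also have "card Gd * k = (\<Sum>g\<in>Gd. k)" by simp
    also have "\<dots> \<le> (\<Sum>g\<in>Gd. 2 * card {u. u < k \<and> bu g u \<noteq> bv g ((u + a g) mod k)})"
    proof (intro sum_mono)
      fix g assume "g \<in> Gd"
      have eq: "{..<k} = {u. u < k \<and> bu g u \<noteq> bv g ((u + a g) mod k)} \<union> {u. u < k \<and> bv g ((u + a g) mod k) = bu g u}"
        by auto
      have "card {..<k} \<le> card {u. u < k \<and> bu g u \<noteq> bv g ((u + a g) mod k)} + card {u. u < k \<and> bv g ((u + a g) mod k) = bu g u}"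
        by (subst eq) (rule card_Un_le)
      then show "k \<le> 2 * card {u. u < k \<and> bu g u \<noteq> bv g ((u + a g) mod k)}"
        using \<open>g \<in> Gd\<close> by (simp add: Gd_def Bad_def)
    qed
    also have "\<dots> \<le> (\<Sum>g<q. 2 * card {u. u < k \<and> bu g u \<noteq> bv g ((u + a g) mod k)})"
      by (intro sum_mono2) (auto simp: Gd_def)
    also have "\<dots> = 2 * card (SIGMA g:{..<q}. {u. u < k \<and> bu g u \<noteq> bv g ((u + a g) mod k)})"
      by (simp add: sum_distrib_left card_SigmaI)
    also have "(SIGMA g:{..<q}. {u. u < k \<and> bu g u \<noteq> bv g ((u + a g) mod k)})
      = {(g, u) \<in> {..<q} \<times> {..<k}. bu g u \<noteq> bv g ((u + a g) mod k)}" by auto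
    finally show False using that by (simp add: S_def)
  qed
  have pow8: "(\<Prod>g<q. if Bad g (a g) then 8 else 1::nat) = 8 ^ card {g. g < q \<and> Bad g (a g)}" for a
    by (subst prod.inter_filter[symmetric]) simp_all
  have power8: "(8::nat) ^ q' = 2 ^ q' * 4 ^ q'" by (simp add: power_mult_distrib[symmetric])
  have "card S * 8 ^ q' = (\<Sum>a\<in>S. 8 ^ q')" by simp
  also have "\<dots> \<le> (\<Sum>a\<in>S. 8 ^ card {g. g < q \<and> Bad g (a g)})"
    using many by (intro sum_mono power_increasing) auto
  also have "\<dots> \<le> (\<Sum>a\<in>A. 8 ^ card {g. g < q \<and> Bad g (a g)})"
    by (intro sum_mono2 finA) (auto simp: S_def)
  also have "\<dots> = (\<Sum>a\<in>A. \<Prod>g<q. if Bad g (a g) then 8 else 1)"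
    by (simp only: pow8)
  also have "\<dots> = (\<Prod>g<q. \<Sum>a<k. if Bad g a then 8 else 1)"
    unfolding A_def by (rule prod_sum_PiE[symmetric]) auto
  also have "\<dots> \<le> (\<Prod>g<q. 2 * k)"
  proof (intro prod_mono conjI)
    fix g assume "g \<in> {..<q}"
    have "(\<Sum>a<k. if Bad g a then 8 else 1::nat) \<le> (\<Sum>a<k. (if Bad g a then 8 else 0) + 1)"
      by (intro sum_mono) auto
    also have "\<dots> = 8 * card {a. a < k \<and> Bad g a} + k"
      unfolding sum.distrib by (subst sum.inter_filter[symmetric]) simp_all
    finally show "(\<Sum>a<k. if Bad g a then 8 else 1::nat) \<le> 2 * k"
      using few[of g] \<open>g \<in> {..<q}\<close> by simp
  qed simp
  also have "\<dots> = 4 ^ q' * k ^ q" by (simp add: q power_mult power_mult_distrib)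
  finally have "(card S * 2 ^ q') * 4 ^ q' \<le> k ^ q * 4 ^ q'"
    by (simp add: power8 mult_ac)
  then have "card S * 2 ^ q' \<le> k ^ q" by simp
  then show ?thesis by (simp add: S_def A_def)
qed

text \<open>Union bound over the pairs \<open>(a, \<epsilon>)\<close>. For one program the rotations
  fail with probability at most 2^(-q'), where q' = b/2; otherwise at least bk/4 = 4 b^2 edges cross
  and the orientation fails with probability at most 2^(-2b). Together this is at most 2 / 2^q', so
  fewer than 2^q' / 2 programs leave a pair that is good for all of them at once.\<close>

lemma exists_unbalanced:
  fixes bu bv :: "'i \<Rightarrow> nat \<Rightarrow> nat \<Rightarrow> nat"
  assumes h: "h > 0" and b: "b = 32768 * h\<^sup>2" and k: "k = 16 * b" and r: "r \<le> 33 * b"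
    and I: "finite I" "2 * card I < 2 ^ (16384 * h\<^sup>2)"
    and bu: "\<And>i g u. i \<in> I \<Longrightarrow> g < b \<Longrightarrow> u < k \<Longrightarrow> bu i g u < r"
    and bv: "\<And>i g u. i \<in> I \<Longrightarrow> g < b \<Longrightarrow> u < k \<Longrightarrow> bv i g u < r"
    and fib: "\<And>i j. i \<in> I \<Longrightarrow> card {e \<in> {..<b} \<times> {..<k}. bu i (fst e) (snd e) = j}
      + card {e \<in> {..<b} \<times> {..<k}. bv i (fst e) (snd e) = j} \<le> b"
  obtains a \<epsilon> where "a \<in> PiE {..<b} (\<lambda>_. {..<k})" "\<epsilon> \<subseteq> {..<b} \<times> {..<k}"
    "\<And>i. i \<in> I \<Longrightarrow> int (b * h) \<le> (\<Sum>j<r. \<bar>imbalance ({..<b} \<times> {..<k})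
        (\<lambda>e. bu i (fst e) (snd e)) (\<lambda>e. bv i (fst e) ((snd e + a (fst e)) mod k)) \<epsilon> j\<bar>)"
proof -
  define E where "E = {..<b} \<times> {..<k}"
  define A where "A = PiE {..<b} (\<lambda>_. {..<k})"
  define q' where "q' = 16384 * h\<^sup>2"
  define x where "x i = (\<lambda>e. bu i (fst e) (snd e))" for i
  define y where "y i a = (\<lambda>e. bv i (fst e) ((snd e + a (fst e)) mod k))" for i and a :: "nat \<Rightarrow> nat"
  define B where "B i = {(a, \<epsilon>) \<in> A \<times> Pow E. (\<Sum>j<r. \<bar>imbalance E (x i) (y i a) \<epsilon> j\<bar>) < int (b * h)}" for i
  have bq: "b = 2 * q'" by (simp add: b q'_def)
  have b0: "b > 0" using b h by simp
  have k0: "k > 0" using k b0 by simp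
  have finE: "finite E" and finA: "finite A" by (auto simp: E_def A_def finite_PiE)
  have cardA: "card A = k ^ b" by (simp add: A_def card_PiE)
  have cardB: "card (B i) * 2 ^ q' \<le> 2 * (card A * 2 ^ card E)" if i: "i \<in> I" for i
  proof -
    define bs where "bs a = {\<epsilon>\<in>Pow E. (\<Sum>j<r. \<bar>imbalance E (x i) (y i a) \<epsilon> j\<bar>) < int (b * h)}" for a
    define S where "S = {a \<in> A. 4 * card {(g, u) \<in> {..<b} \<times> {..<k}. bu i g u \<noteq> bv i g ((u + a g) mod k)} < b * k}"
    have S: "card S * 2 ^ q' \<le> card A"
      unfolding cardA unfolding S_def A_def
    proof (rule random_matchings[OF k b0 bq])
      fix g j assume g: "g < b"
      have "card {v. v < k \<and> bv i g v = j} \<le> card {e \<in> {..<b} \<times> {..<k}. bv i (fst e) (snd e) = j}"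
        by (rule card_inj_on_le[where f = "\<lambda>v. (g, v)"]) (use g in \<open>auto simp: inj_on_def\<close>)
      then show "card {v. v < k \<and> bv i g v = j} \<le> b" using fib[OF i, of j] by linarith
    qed
    have good: "card (bs a) * 2 ^ q' \<le> 2 ^ card E" if a: "a \<in> A" "a \<notin> S" for a
    proof -
      have "card (bs a) * 2 ^ (2 * b) \<le> 2 ^ card E"
        unfolding bs_def
      proof (rule random_signs[OF finE _ _ _ _ r b h])
        show "x i e < r" if "e \<in> E" for e using that bu[OF i] by (auto simp: E_def x_def)
        show "y i a e < r" if "e \<in> E" for e using that bv[OF i] k0 by (auto simp: E_def y_def)
        show "card {e\<in>E. x i e = j} + card {e\<in>E. y i a e = j} \<le> b" for j
        proof -
          have "card {e\<in>E. y i a e = j} = card (SIGMA g:{..<b}. {u. u < k \<and> bv i g ((a g + u) mod k) = j})"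
            by (rule arg_cong[where f = card]) (auto simp: E_def y_def add.commute)
          also have "\<dots> = card (SIGMA g:{..<b}. {v. v < k \<and> bv i g v = j})"
            using card_rotation_fibre[where P = "\<lambda>v. bv i g v = j" and a = "a g" and k = k for g]
            by (simp add: card_SigmaI)
          also have "\<dots> = card {e \<in> {..<b} \<times> {..<k}. bv i (fst e) (snd e) = j}"
            by (rule arg_cong[where f = card]) auto
          finally show ?thesis using fib[OF i, of j] by (simp add: E_def x_def)
        qed
        have "{(g, u) \<in> {..<b} \<times> {..<k}. bu i g u \<noteq> bv i g ((u + a g) mod k)} = {e\<in>E. x i e \<noteq> y i a e}"
          by (auto simp: E_def x_def y_def)
        then have "b * k \<le> 4 * card {e\<in>E. x i e \<noteq> y i a e}" using a by (simp add: S_def not_less)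
        then show "4 * b\<^sup>2 \<le> card {e\<in>E. x i e \<noteq> y i a e}" by (simp add: k power2_eq_square)
      qed
      moreover have "card (bs a) * 2 ^ q' \<le> card (bs a) * 2 ^ (2 * b)"
        using bq by (intro mult_left_mono power_increasing) auto
      ultimately show ?thesis by linarith
    qed
    have "B i = (SIGMA a:A. bs a)" by (auto simp: B_def bs_def)
    then have "card (B i) * 2 ^ q' = (\<Sum>a\<in>A. card (bs a) * 2 ^ q')"
      using finA finE by (simp add: card_SigmaI bs_def sum_distrib_right)
    also have "\<dots> \<le> (\<Sum>a\<in>A. (if a \<in> S then 2 ^ card E * 2 ^ q' else 0) + 2 ^ card E)"
    proof (intro sum_mono)
      fix a assume a: "a \<in> A"
      have "card (bs a) \<le> card (Pow E)" by (rule card_mono) (use finE in \<open>auto simp: bs_def\<close>)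
      then have "card (bs a) * 2 ^ q' \<le> 2 ^ card E * 2 ^ q'" using finE by (simp add: card_Pow)
      then show "card (bs a) * 2 ^ q' \<le> (if a \<in> S then 2 ^ card E * 2 ^ q' else 0) + 2 ^ card E"
        using good[OF a] by (auto intro!: trans_le_add1)
    qed
    also have "\<dots> = (card S * 2 ^ q') * 2 ^ card E + card A * 2 ^ card E"
    proof -
      have "A \<inter> S = S" by (auto simp: S_def)
      then show ?thesis using finA by (simp add: sum.distrib sum.If_cases)
    qed
    also have "\<dots> \<le> 2 * (card A * 2 ^ card E)" using S by simp
    finally show ?thesis .
  qed
  have "card (\<Union>i\<in>I. B i) * 2 ^ q' \<le> (\<Sum>i\<in>I. card (B i)) * 2 ^ q'"
    by (intro mult_right_mono card_UN_le I) simp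
  also have "\<dots> \<le> (\<Sum>i\<in>I. 2 * (card A * 2 ^ card E))"
    unfolding sum_distrib_right by (intro sum_mono cardB)
  also have "\<dots> = (2 * card I) * (card A * 2 ^ card E)" by simp
  also have "\<dots> < 2 ^ q' * (card A * 2 ^ card E)"
    using I(2) k0 by (simp add: q'_def cardA)
  finally have lt: "card (\<Union>i\<in>I. B i) < card (A \<times> Pow E)"
    using finE by (simp add: card_cartesian_product card_Pow mult.commute)
  have "\<not> A \<times> Pow E \<subseteq> (\<Union>i\<in>I. B i)"
  proof
    assume "A \<times> Pow E \<subseteq> (\<Union>i\<in>I. B i)"
    moreover have "(\<Union>i\<in>I. B i) \<subseteq> A \<times> Pow E" by (auto simp: B_def)
    ultimately have "A \<times> Pow E = (\<Union>i\<in>I. B i)" by (rule subset_antisym)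
    with lt show False by (simp only: less_irrefl)
  qed
  then obtain p where p: "p \<in> A \<times> Pow E" "p \<notin> (\<Union>i\<in>I. B i)" by blast
  obtain a \<epsilon> where "p = (a, \<epsilon>)" by (cases p)
  with p have ae: "a \<in> A" "\<epsilon> \<subseteq> E" "\<And>i. i \<in> I \<Longrightarrow> (a, \<epsilon>) \<notin> B i" by auto
  show ?thesis
  proof
    show "a \<in> PiE {..<b} (\<lambda>_. {..<k})" "\<epsilon> \<subseteq> {..<b} \<times> {..<k}" using ae by (auto simp: A_def E_def)
    show "int (b * h) \<le> (\<Sum>j<r. \<bar>imbalance ({..<b} \<times> {..<k})
        (\<lambda>e. bu i (fst e) (snd e)) (\<lambda>e. bv i (fst e) ((snd e + a (fst e)) mod k)) \<epsilon> j\<bar>)" if "i \<in> I" for i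
      using ae(3)[OF that] ae(1,2) unfolding B_def x_def y_def E_def[symmetric] by auto
  qed
qed

section \<open>Rank of two-argument functions\<close>

lemma sum_fun_apply: "(\<Sum>i\<in>A. f i) x = (\<Sum>i\<in>A. f i x)"
  by (induction A rule: infinite_finite_induct) auto


text \<open>Rank as the length of a factorisation. It needs no matrix dimensions and passes directly
  to sums and products; linear algebra enters only when an identity matrix has to be
  bounded.\<close>

definition rank_le :: "nat \<Rightarrow> ('b \<Rightarrow> 'b \<Rightarrow> 'a::comm_semiring_1) \<Rightarrow> bool" where
  "rank_le R M \<longleftrightarrow> (\<exists>\<alpha> \<beta>. \<forall>x y. M x y = (\<Sum>i<R. \<alpha> i x * \<beta> i y))"

lemma rank_leI:
  fixes M :: "'b \<Rightarrow> 'b \<Rightarrow> 'a::comm_semiring_1"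
  assumes "finite S" "card S \<le> R" "\<And>x y. M x y = (\<Sum>i\<in>S. \<alpha> i x * \<beta> i y)"
  shows "rank_le R M"
proof -
  obtain f where f: "bij_betw f {..<card S} S"
    using ex_bij_betw_nat_finite[OF assms(1)] by (auto simp: lessThan_atLeast0)
  define \<alpha>' where "\<alpha>' i x = (if i < card S then \<alpha> (f i) x else 0)" for i x
  have "M x y = (\<Sum>i<R. \<alpha>' i x * \<beta> (f i) y)" for x y
  proof -
    have "M x y = (\<Sum>i<card S. \<alpha> (f i) x * \<beta> (f i) y)"
      unfolding assms(3) by (rule sum.reindex_bij_betw[OF f, symmetric])
    also have "\<dots> = (\<Sum>i<R. \<alpha>' i x * \<beta> (f i) y)"
      using assms(2) by (intro sum.mono_neutral_cong_left) (auto simp: \<alpha>'_def)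
    finally show ?thesis .
  qed
  then show ?thesis unfolding rank_le_def by (intro exI[of _ \<alpha>'] exI[of _ "\<lambda>i. \<beta> (f i)"]) blast
qed

lemma rank_le_const: "rank_le 1 (\<lambda>_ _. c)"
  by (rule rank_leI[of "{()}" _ _ "\<lambda>_ _. c" "\<lambda>_ _. 1"]) auto

lemma rank_le_sum:
  fixes M :: "'i \<Rightarrow> 'b \<Rightarrow> 'b \<Rightarrow> 'a::comm_semiring_1"
  assumes "finite K" "\<And>k. k \<in> K \<Longrightarrow> rank_le (R k) (M k)"
  shows "rank_le (\<Sum>k\<in>K. R k) (\<lambda>x y. \<Sum>k\<in>K. M k x y)"
proof -
  have "\<forall>k. \<exists>\<alpha> \<beta>. k \<in> K \<longrightarrow> (\<forall>x y. M k x y = (\<Sum>i<R k. \<alpha> i x * \<beta> i y))"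
    using assms(2) unfolding rank_le_def by blast
  then obtain \<alpha> \<beta> where ab: "\<And>k x y. k \<in> K \<Longrightarrow> M k x y = (\<Sum>i<R k. \<alpha> k i x * \<beta> k i y)" by metis
  show ?thesis
  proof (rule rank_leI[of "SIGMA k:K. {..<R k}" _ _ "\<lambda>(k, i). \<alpha> k i" "\<lambda>(k, i). \<beta> k i"])
    show "finite (SIGMA k:K. {..<R k})" "card (SIGMA k:K. {..<R k}) \<le> (\<Sum>k\<in>K. R k)"
      using assms(1) by (simp_all add: card_SigmaI)
    show "(\<Sum>k\<in>K. M k x y) = (\<Sum>p\<in>(SIGMA k:K. {..<R k}). (case p of (k, i) \<Rightarrow> \<alpha> k i) x * (case p of (k, i) \<Rightarrow> \<beta> k i) y)" for x y
    proof -
      have "(\<Sum>k\<in>K. M k x y) = (\<Sum>k\<in>K. \<Sum>i<R k. \<alpha> k i x * \<beta> k i y)" by (simp add: ab)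
      also have "\<dots> = (\<Sum>(k, i)\<in>(SIGMA k:K. {..<R k}). \<alpha> k i x * \<beta> k i y)"
        using assms(1) by (intro sum.Sigma) auto
      finally show ?thesis by (simp add: case_prod_unfold)
    qed
  qed
qed

lemma rank_le_mult:
  fixes M N :: "'b \<Rightarrow> 'b \<Rightarrow> 'a::comm_semiring_1"
  assumes "rank_le R M" "rank_le R' N"
  shows "rank_le (R * R') (\<lambda>x y. M x y * N x y)"
proof -
  from assms obtain \<alpha> \<beta> \<alpha>' \<beta>' where
    "\<And>x y. M x y = (\<Sum>i<R. \<alpha> i x * \<beta> i y)" "\<And>x y. N x y = (\<Sum>i<R'. \<alpha>' i x * \<beta>' i y)"
    unfolding rank_le_def by metis
  then have "M x y * N x y = (\<Sum>p\<in>{..<R} \<times> {..<R'}. (\<alpha> (fst p) x * \<alpha>' (snd p) x) * (\<beta> (fst p) y * \<beta>' (snd p) y))" for x y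
    by (simp add: sum_product sum.cartesian_product case_prod_unfold) (intro sum.cong refl, simp add: mult_ac)
  then show ?thesis by (intro rank_leI[of "{..<R} \<times> {..<R'}"]) auto
qed

text \<open>One rank-one term for each possible trace of \<open>x\<close> on \<open>A\<close>: the
  indicator of the trace times the corresponding row.\<close>

lemma rank_le_local_left:
  fixes M :: "'e set \<Rightarrow> 'e set \<Rightarrow> 'a::comm_semiring_1"
  assumes A: "finite A" and M: "\<And>x y. M x y = M (x \<inter> A) y"
  shows "rank_le (2 ^ card A) M"
proof (rule rank_leI[of "Pow A" _ _ "\<lambda>\<rho> x. if x \<inter> A = \<rho> then 1 else 0" "\<lambda>\<rho> y. M \<rho> y"])
  fix x y
  have "(\<Sum>\<rho>\<in>Pow A. (if x \<inter> A = \<rho> then 1 else 0) * M \<rho> y) = (\<Sum>\<rho>\<in>Pow A. if x \<inter> A = \<rho> then M \<rho> y else 0)"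
    by (intro sum.cong) auto
  also have "\<dots> = M (x \<inter> A) y" using A by simp
  also have "\<dots> = M x y" by (rule M[symmetric])
  finally show "M x y = (\<Sum>\<rho>\<in>Pow A. (if x \<inter> A = \<rho> then 1 else 0) * M \<rho> y)" ..
qed (use A in \<open>simp_all add: card_Pow\<close>)

lemma rank_le_transpose:
  assumes "rank_le R (\<lambda>x y. M y x)"
  shows "rank_le R M"
proof -
  from assms obtain \<alpha> \<beta> where "\<And>x y. M y x = (\<Sum>i<R. \<alpha> i x * \<beta> i y)" unfolding rank_le_def by metis
  then show ?thesis by (intro rank_leI[of "{..<R}" _ _ \<beta> \<alpha>]) (auto simp: mult.commute)
qed

text \<open>The minimum is where imbalance pays off: an interval with many rows and few columns is
  charged only for the few.\<close>

lemma rank_le_local: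
  fixes M :: "'e set \<Rightarrow> 'e set \<Rightarrow> 'a::comm_semiring_1"
  assumes "finite A" "finite B" "\<And>x y. M x y = M (x \<inter> A) y" "\<And>x y. M x y = M x (y \<inter> B)"
  shows "rank_le (2 ^ min (card A) (card B)) M"
proof (cases "card A \<le> card B")
  case True
  then show ?thesis using rank_le_local_left[of A M] assms by (simp add: min_def)
next
  case False
  have "rank_le (2 ^ card B) M"
    by (rule rank_le_transpose, rule rank_le_local_left) (use assms in auto)
  then show ?thesis using False by (simp add: min_def)
qed

text \<open>The columns of \<open>M\<close>, cut off outside \<open>T\<close>, are distinct unit
  vectors, hence independent, and lie in the span of the \<open>R\<close> functions
  \<open>v i\<close>. Interpreting the functions as a vector space with scaling \<open>sc\<close>
  makes the bound on independent sets available.\<close>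

lemma rank_le_identity:
  fixes M :: "'b \<Rightarrow> 'b \<Rightarrow> 'a::field"
  assumes "rank_le R M" and T: "finite T" and M: "\<And>x y. x \<in> T \<Longrightarrow> y \<in> T \<Longrightarrow> M x y = (if x = y then 1 else 0)"
  shows "card T \<le> R"
proof -
  define sc :: "'a \<Rightarrow> ('b \<Rightarrow> 'a) \<Rightarrow> 'b \<Rightarrow> 'a" where "sc c f = (\<lambda>x. c * f x)" for c f
  interpret vector_space sc
    by unfold_locales (auto simp: sc_def fun_eq_iff algebra_simps)
  from assms(1) obtain \<alpha> \<beta> where ab: "\<And>x y. M x y = (\<Sum>i<R. \<alpha> i x * \<beta> i y)" unfolding rank_le_def by metis
  define e where "e y = (\<lambda>x. if x \<in> T then M x y else 0)" for y
  define v where "v i = (\<lambda>x. if x \<in> T then \<alpha> i x else 0)" for i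
  have ey: "e y x = (if x = y then 1 else 0)" if "y \<in> T" for x y
    using that M by (auto simp: e_def)
  have inj: "inj_on e T"
    by (rule inj_onI) (metis ey zero_neq_one)
  have span: "e ` T \<subseteq> span (v ` {..<R})"
  proof
    fix f assume "f \<in> e ` T"
    then obtain y where y: "f = e y" by auto
    have "e y = (\<Sum>i<R. sc (\<beta> i y) (v i))"
      by (auto simp: fun_eq_iff e_def v_def ab sc_def mult.commute sum_fun_apply)
    then show "f \<in> span (v ` {..<R})"
      by (simp only: y) (intro span_sum span_scale span_base; auto)
  qed
  have ind: "independent (e ` T)"
  proof (rule independent_if_scalars_zero)
    show "finite (e ` T)" using T by simp
    fix c f assume s: "(\<Sum>g\<in>e ` T. sc (c g) g) = 0" and "f \<in> e ` T"
    then obtain y where y: "y \<in> T" "f = e y" by auto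
    have "0 = (\<Sum>g\<in>e ` T. sc (c g) g) y" using s by simp
    also have "\<dots> = (\<Sum>z\<in>T. c (e z) * e z y)"
      by (simp add: sum.reindex[OF inj] sum_fun_apply sc_def)
    also have "\<dots> = (\<Sum>z\<in>T. if z = y then c (e z) else 0)"
      by (intro sum.cong) (auto simp: ey)
    also have "\<dots> = c f" using T y by simp
    finally show "c f = 0" by simp
  qed
  have "card (e ` T) \<le> card (v ` {..<R})"
    using independent_span_bound[OF _ ind span] by simp
  also have "\<dots> \<le> R" using card_image_le[of "{..<R}" v] by simp
  finally show ?thesis by (simp add: card_image[OF inj])
qed

section \<open>Evaluation of polynomials and of branching programs\<close>

definition mono_eval :: "(nat \<Rightarrow> 'a::comm_ring_1) \<Rightarrow> (nat \<Rightarrow>\<^sub>0 nat) \<Rightarrow> 'a" where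
  "mono_eval \<phi> \<mu> = (\<Prod>v\<in>Poly_Mapping.keys \<mu>. \<phi> v ^ Poly_Mapping.lookup \<mu> v)"

definition peval :: "(nat \<Rightarrow> 'a::comm_ring_1) \<Rightarrow> 'a mpoly \<Rightarrow> 'a" where
  "peval \<phi> P = (\<Sum>\<mu>\<in>Poly_Mapping.keys P. Poly_Mapping.lookup P \<mu> * mono_eval \<phi> \<mu>)"

lemma mono_eval_superset:
  assumes "finite A" "Poly_Mapping.keys \<mu> \<subseteq> A"
  shows "mono_eval \<phi> \<mu> = (\<Prod>v\<in>A. \<phi> v ^ Poly_Mapping.lookup \<mu> v)"
  unfolding mono_eval_def using assms
  by (intro prod.mono_neutral_left) (auto simp: in_keys_iff)

lemma mono_eval_add: "mono_eval \<phi> (\<mu> + \<nu>) = mono_eval \<phi> \<mu> * mono_eval \<phi> \<nu>"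
proof -
  let ?A = "Poly_Mapping.keys \<mu> \<union> Poly_Mapping.keys \<nu>"
  have "mono_eval \<phi> (\<mu> + \<nu>) = (\<Prod>v\<in>?A. \<phi> v ^ Poly_Mapping.lookup (\<mu> + \<nu>) v)"
    by (rule mono_eval_superset) (auto simp: keys_add)
  also have "\<dots> = (\<Prod>v\<in>?A. \<phi> v ^ Poly_Mapping.lookup \<mu> v) * (\<Prod>v\<in>?A. \<phi> v ^ Poly_Mapping.lookup \<nu> v)"
    by (simp add: lookup_add power_add prod.distrib)
  also have "\<dots> = mono_eval \<phi> \<mu> * mono_eval \<phi> \<nu>"
    by (simp add: mono_eval_superset[of ?A])
  finally show ?thesis .
qed

lemma peval_superset:
  assumes "finite A" "Poly_Mapping.keys P \<subseteq> A"
  shows "peval \<phi> P = (\<Sum>\<mu>\<in>A. Poly_Mapping.lookup P \<mu> * mono_eval \<phi> \<mu>)"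
  unfolding peval_def using assms
  by (intro sum.mono_neutral_left) (auto simp: in_keys_iff)

lemma peval_add: "peval \<phi> (P + Q) = peval \<phi> P + peval \<phi> Q"
proof -
  let ?A = "Poly_Mapping.keys P \<union> Poly_Mapping.keys Q"
  have "peval \<phi> (P + Q) = (\<Sum>v\<in>?A. Poly_Mapping.lookup (P + Q) v * mono_eval \<phi> v)"
    by (rule peval_superset) (auto simp: keys_add)
  also have "\<dots> = peval \<phi> P + peval \<phi> Q"
    by (simp add: lookup_add algebra_simps sum.distrib peval_superset[of ?A])
  finally show ?thesis .
qed

lemma peval_zero [simp]: "peval \<phi> 0 = 0"
  by (simp add: peval_def)

lemma peval_single: "peval \<phi> (Poly_Mapping.single \<mu> c) = c * mono_eval \<phi> \<mu>"
  by (simp add: peval_def)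

lemma peval_one [simp]: "peval \<phi> 1 = 1"
  using peval_single[of \<phi> 0 1] by (simp add: mono_eval_def)

lemma peval_Var [simp]: "peval \<phi> (Var v) = \<phi> v"
  by (simp add: Var_def peval_single mono_eval_def)

lemma peval_sum: "peval \<phi> (sum f A) = (\<Sum>i\<in>A. peval \<phi> (f i))"
  by (induction A rule: infinite_finite_induct) (auto simp: peval_add)

lemma peval_mult: "peval \<phi> (P * Q) = peval \<phi> P * peval \<phi> Q"
proof -
  have sm: "P = (\<Sum>\<mu>\<in>Poly_Mapping.keys P. Poly_Mapping.single \<mu> (Poly_Mapping.lookup P \<mu>))" for P :: "'a mpoly"
    by (intro poly_mapping_eqI) (auto simp: lookup_sum lookup_single when_def in_keys_iff)
  have "peval \<phi> (P * Q) = peval \<phi> ((\<Sum>\<mu>\<in>Poly_Mapping.keys P. Poly_Mapping.single \<mu> (Poly_Mapping.lookup P \<mu>)) *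
      (\<Sum>\<nu>\<in>Poly_Mapping.keys Q. Poly_Mapping.single \<nu> (Poly_Mapping.lookup Q \<nu>)))"
    by (rule arg_cong2[where f = "\<lambda>A B. peval \<phi> (A * B)", OF sm sm])
  also have "\<dots> = peval \<phi> P * peval \<phi> Q"
    by (simp add: sum_product peval_sum mult_single peval_single mono_eval_add)
      (simp add: peval_def sum_product algebra_simps)
  finally show ?thesis .
qed

lemma peval_prod: "peval \<phi> (prod f A) = (\<Prod>i\<in>A. peval \<phi> (f i))"
  by (induction A rule: infinite_finite_induct) (auto simp: peval_mult)

lemma peval_linear_form_cong:
  assumes "linear_form_in S L" "\<And>v. v \<in> S \<Longrightarrow> \<phi> v = \<psi> v"
  shows "peval \<phi> L = peval \<psi> L"
  unfolding peval_def
proof (intro sum.cong refl)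
  fix \<mu> assume "\<mu> \<in> Poly_Mapping.keys L"
  then obtain v where "v \<in> S" "\<mu> = Poly_Mapping.single v 1"
    using assms(1) unfolding linear_form_in_def by blast
  then have "mono_eval \<phi> \<mu> = mono_eval \<psi> \<mu>" using assms(2) by (simp add: mono_eval_def)
  then show "Poly_Mapping.lookup L \<mu> * mono_eval \<phi> \<mu> = Poly_Mapping.lookup L \<mu> * mono_eval \<psi> \<mu>" by simp
qed

section \<open>Path sums as iterated matrix products\<close>

text \<open>The path sum from node \<open>i\<close> of layer \<open>a\<close> to node
  \<open>j\<close> of layer \<open>a + l\<close>. The free starting layer allows a program to be cut
  into intervals. The target \<open>j\<close> is not restricted to existing nodes, which is why
  composition requires a bound on it.\<close>

fun transfer :: "(nat \<Rightarrow> nat) \<Rightarrow> (nat \<Rightarrow> nat \<Rightarrow> nat \<Rightarrow> 'a::comm_semiring_1) \<Rightarrow> nat \<Rightarrow> nat \<Rightarrow> nat \<Rightarrow> nat \<Rightarrow> 'a" where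
  "transfer w L a i 0 j = (if i = j then 1 else 0)"
| "transfer w L a i (Suc l) j = (\<Sum>k<w (a + l). transfer w L a i l k * L (Suc (a + l)) k j)"

lemma transfer_add:
  assumes "j < w (a + (l + l'))"
  shows "transfer w L a i (l + l') j = (\<Sum>k<w (a + l). transfer w L a i l k * transfer w L (a + l) k l' j)"
  using assms
proof (induction l' arbitrary: j)
  case 0
  then show ?case by (simp add: if_distrib[of "(*) _"] cong: if_cong)
next
  case (Suc l')
  have "transfer w L a i (l + Suc l') j
      = (\<Sum>x<w (a + (l + l')). (\<Sum>k<w (a + l). transfer w L a i l k * transfer w L (a + l) k l' x) * L (Suc (a + (l + l'))) x j)"
    using Suc.IH by simp
  also have "\<dots> = (\<Sum>k<w (a + l). \<Sum>x<w (a + (l + l')). transfer w L a i l k * transfer w L (a + l) k l' x * L (Suc (a + (l + l'))) x j)"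
    unfolding sum_distrib_right by (rule sum.swap)
  also have "\<dots> = (\<Sum>k<w (a + l). transfer w L a i l k * transfer w L (a + l) k (Suc l') j)"
    by (simp add: sum_distrib_left mult.assoc add.assoc)
  finally show ?case .
qed

text \<open>Agreement is demanded only on edges that a path to \<open>j\<close> can use, because
  labels of a program are controlled only between existing nodes. In the last step the only possible
  head is \<open>j\<close> itself.\<close>

lemma transfer_cong:
  assumes "\<And>x. x < l \<Longrightarrow> w (a + x) = w' (a' + x)"
    and "\<And>x y z. x < l \<Longrightarrow> y < w (a + x) \<Longrightarrow> (x = l - 1 \<longrightarrow> z = j) \<Longrightarrow> (Suc x < l \<longrightarrow> z < w (a + Suc x)) \<Longrightarrow> L (Suc (a + x)) y z = L' (Suc (a' + x)) y z"
  shows "transfer w L a i l j = transfer w' L' a' i l j"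
  using assms
proof (induction l arbitrary: j)
  case (Suc l)
  have "transfer w L a i (Suc l) j = (\<Sum>k<w (a + l). transfer w' L' a' i l k * L' (Suc (a' + l)) k j)"
    unfolding transfer.simps
  proof (intro sum.cong refl)
    fix k assume k: "k \<in> {..<w (a + l)}"
    have "transfer w L a i l k = transfer w' L' a' i l k"
    proof (rule Suc.IH)
      show "w (a + x) = w' (a' + x)" if "x < l" for x using Suc.prems(1) that by simp
      show "L (Suc (a + x)) y z = L' (Suc (a' + x)) y z"
        if "x < l" "y < w (a + x)" "x = l - 1 \<longrightarrow> z = k" "Suc x < l \<longrightarrow> z < w (a + Suc x)" for x y z
      proof (rule Suc.prems(2))
        show "x = Suc l - 1 \<longrightarrow> z = j" using that by simp
        show "Suc x < Suc l \<longrightarrow> z < w (a + Suc x)"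
        proof (cases "Suc x = l")
          case True
          then show ?thesis using that k by simp
        qed (use that in simp)
      qed (use that in auto)
    qed
    moreover have "L (Suc (a + l)) k j = L' (Suc (a' + l)) k j"
      using Suc.prems(2)[of l k j] k by simp
    ultimately show "transfer w L a i l k * L (Suc (a + l)) k j = transfer w' L' a' i l k * L' (Suc (a' + l)) k j"
      by simp
  qed
  then show ?case using Suc.prems(1)[of l] by simp
qed simp

lemma peval_transfer: "peval \<phi> (transfer w L a i l j) = transfer w (\<lambda>l j k. peval \<phi> (L l j k)) a i l j"
  by (induction l arbitrary: j) (auto simp: peval_sum peval_mult)

lemma abp_paths_Suc:
  "bij_betw (\<lambda>(p, k). p(Suc d := k)) (abp_paths d w \<times> {..<w (Suc d)}) (abp_paths (Suc d) w)"
proof (rule bij_betw_byWitness[where f' = "\<lambda>p. (p(Suc d := 0), p (Suc d))"])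
  show "\<forall>a\<in>abp_paths d w \<times> {..<w (Suc d)}. (\<lambda>p. (p(Suc d := 0), p (Suc d))) ((\<lambda>(p, k). p(Suc d := k)) a) = a"
    by (auto simp: abp_paths_def fun_eq_iff)
next
  show "\<forall>p\<in>abp_paths (Suc d) w. (\<lambda>(p, k). p(Suc d := k)) (p(Suc d := 0), p (Suc d)) = p"
    by simp
  show "(\<lambda>(p, k). p(Suc d := k)) ` (abp_paths d w \<times> {..<w (Suc d)}) \<subseteq> abp_paths (Suc d) w"
    by (auto simp: abp_paths_def le_Suc_eq)
  show "(\<lambda>p. (p(Suc d := 0), p (Suc d))) ` abp_paths (Suc d) w \<subseteq> abp_paths d w \<times> {..<w (Suc d)}"
    by (auto simp: abp_paths_def)
qed

text \<open>The weight \<open>f\<close> on the last node is what the induction needs: the label of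
  the final edge is absorbed into the weight of the node before it.\<close>

lemma abp_paths_sum:
  fixes L :: "nat \<Rightarrow> nat \<Rightarrow> nat \<Rightarrow> 'a::comm_ring_1 mpoly"
  assumes "w 0 = 1"
  shows "(\<Sum>p\<in>abp_paths d w. (\<Prod>l\<in>{1..d}. L l (p (l - 1)) (p l)) * f (p d))
    = (\<Sum>k<w d. transfer w L 0 0 d k * f k)"
proof (induction d arbitrary: f)
  case 0
  have "abp_paths 0 w = {\<lambda>_. 0}" using assms by (auto simp: abp_paths_def fun_eq_iff) (metis gr0I)
  then show ?case using assms by simp
next
  case (Suc d)
  have "(\<Sum>p\<in>abp_paths (Suc d) w. (\<Prod>l\<in>{1..Suc d}. L l (p (l - 1)) (p l)) * f (p (Suc d)))
      = (\<Sum>(p, k)\<in>abp_paths d w \<times> {..<w (Suc d)}. (\<Prod>l\<in>{1..Suc d}. L l ((p(Suc d := k)) (l - 1)) ((p(Suc d := k)) l)) * f k)"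
    by (subst sum.reindex_bij_betw[OF abp_paths_Suc, symmetric]) (simp add: case_prod_unfold)
  also have "\<dots> = (\<Sum>(p, k)\<in>abp_paths d w \<times> {..<w (Suc d)}. (\<Prod>l\<in>{1..d}. L l (p (l - 1)) (p l)) * (L (Suc d) (p d) k * f k))"
    by (intro sum.cong refl) (auto simp: mult.assoc intro!: arg_cong2[of _ _ _ _ "(*)"] prod.cong)
  also have "\<dots> = (\<Sum>p\<in>abp_paths d w. (\<Prod>l\<in>{1..d}. L l (p (l - 1)) (p l)) * (\<Sum>k<w (Suc d). L (Suc d) (p d) k * f k))"
    by (simp add: sum.cartesian_product[symmetric] sum_distrib_left)
  also have "\<dots> = (\<Sum>i<w d. transfer w L 0 0 d i * (\<Sum>k<w (Suc d). L (Suc d) i k * f k))"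
    by (rule Suc.IH)
  also have "\<dots> = (\<Sum>k<w (Suc d). transfer w L 0 0 (Suc d) k * f k)"
    by (simp add: sum_distrib_left sum_distrib_right mult.assoc) (rule sum.swap)
  finally show ?case .
qed

lemma abp_eval_transfer:
  assumes "w 0 = 1" "w d = 1"
  shows "abp_eval d w L = transfer w L 0 0 d 0"
  using abp_paths_sum[where w = w and d = d and L = L and f = "\<lambda>_. 1", OF assms(1)] assms(2) by (simp add: abp_eval_def)

section \<open>Products and sums of branching programs\<close>

text \<open>A normal form closed under concatenation and parallel composition: constant width, a
  prescribed length, and value 0 at every final node other than node 0, so that nothing leaks into a
  following program.\<close>

definition width_computable :: "nat \<Rightarrow> nat \<Rightarrow> 'a::comm_ring_1 mpoly \<Rightarrow> bool" where
  "width_computable s d P \<longleftrightarrow> (\<exists>L. (\<forall>l j k. linear_poly (L l j k)) \<and>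
     (\<forall>j<s. transfer (\<lambda>_. s) L 0 0 d j = (if j = 0 then P else 0)))"

lemma linear_poly_0 [simp]: "linear_poly 0"
  by (simp add: linear_poly_def)

lemma linear_poly_1 [simp]: "linear_poly 1"
  by (simp add: linear_poly_def mono_deg_def)

lemma linear_poly_Var [simp]: "linear_poly (Var v)"
  by (simp add: linear_poly_def Var_def mono_deg_def)

lemma width_computable_one: "width_computable s 0 1"
  unfolding width_computable_def by (rule exI[of _ "\<lambda>_ _ _. 0"]) simp

lemma width_computable_linear:
  assumes "linear_poly P" "s > 0"
  shows "width_computable s 1 P"
  unfolding width_computable_def
  by (rule exI[of _ "\<lambda>_ j k. if j = 0 \<and> k = 0 then P else 0"])
    (use assms in \<open>auto simp: if_distrib[of "(*) _"] if_distribR cong: if_cong\<close>)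

lemma width_computable_mult:
  fixes P Q :: "'a::comm_ring_1 mpoly"
  assumes "width_computable s d P" "width_computable s e Q" "s > 0"
  shows "width_computable s (d + e) (P * Q)"
proof -
  from assms obtain L M where L: "\<And>l j k. linear_poly (L l j k)" and M: "\<And>l j k. linear_poly (M l j k)"
    and tL: "\<And>j. j < s \<Longrightarrow> transfer (\<lambda>_. s) L 0 0 d j = (if j = 0 then P else 0)"
    and tM: "\<And>j. j < s \<Longrightarrow> transfer (\<lambda>_. s) M 0 0 e j = (if j = 0 then Q else 0)"
    unfolding width_computable_def by metis
  define N where "N l = (if l \<le> d then L l else M (l - d))" for l
  have 1: "transfer (\<lambda>_. s) N 0 0 d j = transfer (\<lambda>_. s) L 0 0 d j" for j
    by (rule transfer_cong) (auto simp: N_def)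
  have 2: "transfer (\<lambda>_. s) N d 0 e j = transfer (\<lambda>_. s) M 0 0 e j" for j
    by (rule transfer_cong) (auto simp: N_def)
  show ?thesis
    unfolding width_computable_def
  proof (intro exI[of _ N] conjI allI impI)
    show "linear_poly (N l j k)" for l j k using L M by (simp add: N_def)
    fix j assume j: "j < s"
    have "transfer (\<lambda>_. s) N 0 0 (d + e) j = (\<Sum>k<s. transfer (\<lambda>_. s) N 0 0 d k * transfer (\<lambda>_. s) N d k e j)"
      using transfer_add[of j "\<lambda>_. s" 0 d e N 0] j by simp
    also have "\<dots> = (\<Sum>k<s. if k = 0 then P * transfer (\<lambda>_. s) N d k e j else 0)"
      by (intro sum.cong) (auto simp: 1 tL)
    also have "\<dots> = P * transfer (\<lambda>_. s) N d 0 e j" using assms(3) by simp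
    finally show "transfer (\<lambda>_. s) N 0 0 (d + e) j = (if j = 0 then P * Q else 0)"
      using j by (simp add: 2 tM)
  qed
qed

lemma width_computable_prod:
  fixes P :: "nat \<Rightarrow> 'a::comm_ring_1 mpoly"
  assumes "\<And>i. i < q \<Longrightarrow> width_computable s d (P i)" "s > 0"
  shows "width_computable s (q * d) (\<Prod>i<q. P i)"
  using assms(1)
proof (induction q)
  case 0
  then show ?case by (simp add: width_computable_one)
next
  case (Suc q)
  have "width_computable s (q * d + d) ((\<Prod>i<q. P i) * P q)"
    using Suc assms(2) by (intro width_computable_mult) auto
  then show ?case by (simp add: add.commute mult.commute)
qed

lemma width_computable_sum:
  fixes P :: "nat \<Rightarrow> 'a::comm_ring_1 mpoly"
  assumes P: "\<And>i. i < k \<Longrightarrow> width_computable s d (P i)" and s: "s > 0"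
  shows "width_computable (k * s) (d + 2) (\<Sum>i<k. P i)"
proof -
  have "\<forall>i. \<exists>L. i < k \<longrightarrow> (\<forall>l j k. linear_poly (L l j k)) \<and>
     (\<forall>j<s. transfer (\<lambda>_. s) L 0 0 d j = (if j = 0 then P i else 0))"
    using P unfolding width_computable_def by blast
  then obtain L where L: "\<And>i l j k'. i < k \<Longrightarrow> linear_poly (L i l j k')"
    and tL: "\<And>i j. i < k \<Longrightarrow> j < s \<Longrightarrow> transfer (\<lambda>_. s) (L i) 0 0 d j = (if j = 0 then P i else 0)"
    by metis
  \<comment> \<open>Node \<open>i * s + x\<close> represents node \<open>x\<close> of copy
    \<open>i\<close>. Layer 1 fans out with label 1 to node 0 of each copy and layer
    \<open>d + 2\<close> collects from these nodes; in between the copies run side by side, their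
    layers shifted by one.\<close>
  define N where "N l x y =
    (if l = 1 then (if x = 0 \<and> y mod s = 0 then 1 else 0)
     else if l = d + 2 then (if x mod s = 0 \<and> y = 0 then 1 else 0)
     else if x div s = y div s \<and> x div s < k then L (x div s) (l - 1) (x mod s) (y mod s) else 0)" for l x y
  let ?S = "\<lambda>_::nat. k * s"
  have split: "(\<Sum>x<k * s. f x) = (\<Sum>i<k. \<Sum>x<s. f (i * s + x))" for f :: "nat \<Rightarrow> 'a mpoly"
  proof -
    have "(\<Sum>x<k * s. f x) = (\<Sum>i<k. sum f {i * s..<i * s + s})"
      by (rule sum.nat_group[symmetric])
    also have "(\<Sum>i<k. sum f {i * s..<i * s + s}) = (\<Sum>i<k. \<Sum>x<s. f (i * s + x))"
    proof (rule sum.cong[OF refl])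
      fix i
      have "sum f {i * s..<i * s + s} = sum f {0 + i * s..<s + i * s}" by (simp add: add.commute)
      also have "\<dots> = (\<Sum>x<s. f (i * s + x))"
        unfolding sum.shift_bounds_nat_ivl lessThan_atLeast0 by (simp only: add.commute)
      finally show "sum f {i * s..<i * s + s} = (\<Sum>x<s. f (i * s + x))" .
    qed
    finally show ?thesis .
  qed
  have inv: "transfer ?S N 0 0 (Suc l) (i * s + x) = transfer (\<lambda>_. s) (L i) 0 0 l x"
    if "i < k" "x < s" "l \<le> d" for l i x
    using that
  proof (induction l arbitrary: i x)
    case 0
    have "0 < k * s" using 0 by auto
    then show ?case using 0
      by (simp add: N_def if_distrib[of "(*) _"] if_distribR cong: if_cong)
  next
    case (Suc l)
    have "transfer ?S N 0 0 (Suc (Suc l)) (i * s + x)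
      = (\<Sum>i'<k. \<Sum>x'<s. transfer ?S N 0 0 (Suc l) (i' * s + x') * N (Suc (Suc l)) (i' * s + x') (i * s + x))"
      by (subst transfer.simps) (simp only: split add_0)
    also have "\<dots> = (\<Sum>i'<k. if i' = i then (\<Sum>x'<s. transfer (\<lambda>_. s) (L i) 0 0 l x' * L i (Suc l) x' x) else 0)"
    proof (intro sum.cong refl)
      fix i' assume i': "i' \<in> {..<k}"
      have "(\<Sum>x'<s. transfer ?S N 0 0 (Suc l) (i' * s + x') * N (Suc (Suc l)) (i' * s + x') (i * s + x))
        = (\<Sum>x'<s. if i' = i then transfer (\<lambda>_. s) (L i) 0 0 l x' * L i (Suc l) x' x else 0)"
      proof (intro sum.cong refl)
        fix x' assume x': "x' \<in> {..<s}"
        have "N (Suc (Suc l)) (i' * s + x') (i * s + x) = (if i' = i then L i (Suc l) x' x else 0)"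
          using Suc.prems i' x' by (simp add: N_def)
        moreover have "transfer ?S N 0 0 (Suc l) (i' * s + x') = transfer (\<lambda>_. s) (L i') 0 0 l x'"
          using Suc.IH[of i' x'] Suc.prems i' x' by (simp del: transfer.simps)
        ultimately show "transfer ?S N 0 0 (Suc l) (i' * s + x') * N (Suc (Suc l)) (i' * s + x') (i * s + x)
          = (if i' = i then transfer (\<lambda>_. s) (L i) 0 0 l x' * L i (Suc l) x' x else 0)"
          by (simp del: transfer.simps)
      qed
      then show "(\<Sum>x'<s. transfer ?S N 0 0 (Suc l) (i' * s + x') * N (Suc (Suc l)) (i' * s + x') (i * s + x))
        = (if i' = i then (\<Sum>x'<s. transfer (\<lambda>_. s) (L i) 0 0 l x' * L i (Suc l) x' x) else 0)" by simp
    qed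
    also have "\<dots> = transfer (\<lambda>_. s) (L i) 0 0 (Suc l) x" using Suc.prems by simp
    finally show ?case .
  qed
  show ?thesis
    unfolding width_computable_def
  proof (intro exI[of _ N] conjI allI impI)
    show "linear_poly (N l x y)" for l x y using L by (simp add: N_def)
    fix j assume j: "j < k * s"
    have "transfer ?S N 0 0 (d + 2) j = (\<Sum>i<k. \<Sum>x<s. transfer ?S N 0 0 (Suc d) (i * s + x) * N (Suc (Suc d)) (i * s + x) j)"
      unfolding add_2_eq_Suc' by (subst transfer.simps) (simp only: split add_0)
    also have "\<dots> = (\<Sum>i<k. \<Sum>x<s. if x = 0 then if j = 0 then P i else 0 else 0)"
    proof (intro sum.cong refl)
      fix i x assume ix: "i \<in> {..<k}" "x \<in> {..<s}"
      have "transfer ?S N 0 0 (Suc d) (i * s + x) = (if x = 0 then P i else 0)"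
        using ix tL[of i x] inv[of i x d] by (simp del: transfer.simps)
      moreover have "N (Suc (Suc d)) (i * s + x) j = (if x = 0 \<and> j = 0 then 1 else 0)"
        using ix by (simp add: N_def)
      ultimately show "transfer ?S N 0 0 (Suc d) (i * s + x) * N (Suc (Suc d)) (i * s + x) j
        = (if x = 0 then if j = 0 then P i else 0 else 0)"
        by (simp del: transfer.simps)
    qed
    also have "\<dots> = (\<Sum>i<k. if j = 0 then P i else 0)"
      using s by simp
    finally show "transfer ?S N 0 0 (d + 2) j = (if j = 0 then \<Sum>i<k. P i else 0)" by simp
  qed
qed

lemma width_computable_abp:
  fixes P :: "'a::comm_ring_1 mpoly"
  assumes "width_computable s d P" "s > 0"
  obtains w L where "is_abp d w L" "abp_eval d w L = P" "abp_size d w \<le> (d + 1) * s"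
proof -
  from assms obtain L where L: "\<And>l j k. linear_poly (L l j k)"
    and t: "transfer (\<lambda>_. s) L 0 0 d 0 = P"
    unfolding width_computable_def by metis
  \<comment> \<open>The outer layers shrink to single nodes, as \<open>is_abp\<close> demands. This
    preserves the value: the removed start nodes have path sum 0, and the target is node 0.\<close>
  define w where "w l = (if l = 0 \<or> l = d then 1 else s)" for l
  have inv: "transfer w L 0 0 l k = transfer (\<lambda>_. s) L 0 0 l k" if "l \<le> d" for l k
    using that
  proof (induction l arbitrary: k)
    case (Suc l)
    show ?case
    proof (cases "l = 0")
      case True
      have "(\<Sum>x<s. (if (0::nat) = x then 1 else 0) * L (Suc 0) x k) = L (Suc 0) 0 k"
        using assms(2) by (simp add: if_distrib[of "\<lambda>y. y * _"] cong: if_cong)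
      then show ?thesis using True by (simp add: w_def)
    qed (use Suc in \<open>simp add: w_def\<close>)
  qed simp
  show ?thesis
  proof
    show "is_abp d w L" using L by (auto simp: is_abp_def w_def)
    show "abp_eval d w L = P"
    proof -
      have "w 0 = 1" "w d = 1" by (simp_all add: w_def)
      then show ?thesis by (simp add: abp_eval_transfer inv t)
    qed
    have "abp_size d w \<le> (\<Sum>l\<le>d. s)"
      unfolding abp_size_def by (intro sum_mono) (use assms(2) in \<open>auto simp: w_def\<close>)
    then show "abp_size d w \<le> (d + 1) * s" by simp
  qed
qed

section \<open>Rank of ordered set-multilinear branching programs\<close>

lemma rank_le_mono: "rank_le R M \<Longrightarrow> R \<le> R' \<Longrightarrow> rank_le R' M"
  unfolding rank_le_def[of R] by (auto intro: rank_leI[of "{..<R}"])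

text \<open>Every path passes through one of at most W nodes at each multiple of \<open>b\<close>.
  The part between two cuts uses only variables of the buckets in its interval, hence sees
  \<open>\<tau>\<close> and \<open>\<tau>'\<close> only through \<open>Y j\<close> and
  \<open>Z j\<close>. Each interval thus multiplies the rank by at most W times a local factor. The
  matrix entries are values at the points \<open>val \<tau> \<tau>'\<close>.\<close>

lemma smabp_rank_le:
  fixes L :: "nat \<Rightarrow> nat \<Rightarrow> nat \<Rightarrow> 'a::comm_ring_1 mpoly" and val :: "'e set \<Rightarrow> 'e set \<Rightarrow> nat \<Rightarrow> 'a"
  assumes sm: "is_smabp m X \<sigma> w L" and m: "m = r * b"
    and fin: "\<And>j. finite (Y j)" "\<And>j. finite (Z j)"
    and Y: "\<And>l v \<tau> \<tau>'. l < m \<Longrightarrow> v \<in> X (\<sigma> l) \<Longrightarrow> val \<tau> \<tau>' v = val (\<tau> \<inter> Y (l div b)) \<tau>' v"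
    and Z: "\<And>l v \<tau> \<tau>'. l < m \<Longrightarrow> v \<in> X (\<sigma> l) \<Longrightarrow> val \<tau> \<tau>' v = val \<tau> (\<tau>' \<inter> Z (l div b)) v"
  shows "rank_le (abp_width m w ^ r * 2 ^ (\<Sum>j<r. min (card (Y j)) (card (Z j))))
    (\<lambda>\<tau> \<tau>'. peval (val \<tau> \<tau>') (abp_eval m w L))"
proof -
  have w01: "w 0 = 1" "w m = 1"
    and lin: "\<And>l j k. l < m \<Longrightarrow> j < w l \<Longrightarrow> k < w (Suc l) \<Longrightarrow> linear_form_in (X (\<sigma> l)) (L (Suc l) j k)"
  proof -
    show "w 0 = 1" "w m = 1" using sm by (auto simp: is_smabp_def)
    have all: "\<forall>l\<in>{1..m}. \<forall>j<w (l - 1). \<forall>k<w l. linear_form_in (X (\<sigma> (l - 1))) (L l j k)"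
      using sm by (simp add: is_smabp_def)
    show "linear_form_in (X (\<sigma> l)) (L (Suc l) j k)" if "l < m" "j < w l" "k < w (Suc l)" for l j k
      using bspec[OF all, of "Suc l"] that by simp
  qed
  define W where "W = abp_width m w"
  have W: "w l \<le> W" if "l \<le> m" for l
    unfolding W_def abp_width_def using that by (intro Max_ge) auto
  have block: "rank_le (2 ^ min (card (Y j)) (card (Z j)))
      (\<lambda>\<tau> \<tau>'. peval (val \<tau> \<tau>') (transfer w L (j * b) i b k))"
    if j: "j < r" and k: "k < w (j * b + b)" for i j k
  proof (rule rank_le_local[OF fin])
    have eq: "peval \<phi> (transfer w L (j * b) i b k) = peval \<psi> (transfer w L (j * b) i b k)"
      if eq: "\<And>l v. l < m \<Longrightarrow> l div b = j \<Longrightarrow> v \<in> X (\<sigma> l) \<Longrightarrow> \<phi> v = \<psi> v" for \<phi> \<psi> :: "nat \<Rightarrow> 'a"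
      unfolding peval_transfer
    proof (rule transfer_cong)
      fix x y z assume x: "x < b" "y < w (j * b + x)"
        and z: "x = b - 1 \<longrightarrow> z = k" "Suc x < b \<longrightarrow> z < w (j * b + Suc x)"
      have "j * b + x < Suc j * b" using x by simp
      also have "\<dots> \<le> m" unfolding m using j by (intro mult_right_mono) auto
      finally have lt: "j * b + x < m" .
      have "z < w (Suc (j * b + x))"
      proof (cases "Suc x = b")
        case True
        then show ?thesis using z k by auto
      qed (use x z in simp)
      then have "linear_form_in (X (\<sigma> (j * b + x))) (L (Suc (j * b + x)) y z)"
        using lin lt x by blast
      then show "peval \<phi> (L (Suc (j * b + x)) y z) = peval \<psi> (L (Suc (j * b + x)) y z)"
        by (rule peval_linear_form_cong) (use eq[of "j * b + x"] lt x in auto)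
    qed simp
    show "peval (val \<tau> \<tau>') (transfer w L (j * b) i b k) = peval (val (\<tau> \<inter> Y j) \<tau>') (transfer w L (j * b) i b k)" for \<tau> \<tau>'
      by (rule eq) (use Y in blast)
    show "peval (val \<tau> \<tau>') (transfer w L (j * b) i b k) = peval (val \<tau> (\<tau>' \<inter> Z j)) (transfer w L (j * b) i b k)" for \<tau> \<tau>'
      by (rule eq) (use Z in blast)
  qed
  have "rank_le (W ^ j * 2 ^ (\<Sum>j<j. min (card (Y j)) (card (Z j))))
    (\<lambda>\<tau> \<tau>'. peval (val \<tau> \<tau>') (transfer w L 0 0 (j * b) k))" if "j \<le> r" "k < w (j * b)" for j k
    using that
  proof (induction j arbitrary: k)
    case 0
    have "rank_le 1 (\<lambda>\<tau> \<tau>'. if 0 = k then 1 else (0::'a))" by (rule rank_le_const)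
    then show ?case by (simp add: if_distrib[of "peval _"] cong: if_cong)
  next
    case (Suc j)
    define S where "S = (\<Sum>j<j. min (card (Y j)) (card (Z j)))"
    define \<mu> where "\<mu> = min (card (Y j)) (card (Z j))"
    have jb: "j * b \<le> m" unfolding m using Suc.prems by (intro mult_right_mono) auto
    have "transfer w L 0 0 (j * b + b) k = (\<Sum>i<w (j * b). transfer w L 0 0 (j * b) i * transfer w L (j * b) i b k)"
      using transfer_add[of k w 0 "j * b" b L 0] Suc.prems by (simp add: add.commute)
    then have eq: "(\<lambda>\<tau> \<tau>'. peval (val \<tau> \<tau>') (transfer w L 0 0 (Suc j * b) k))
      = (\<lambda>\<tau> \<tau>'. \<Sum>i<w (j * b). peval (val \<tau> \<tau>') (transfer w L 0 0 (j * b) i) * peval (val \<tau> \<tau>') (transfer w L (j * b) i b k))"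
      by (simp add: add.commute peval_sum peval_mult)
    have "rank_le (\<Sum>i<w (j * b). (W ^ j * 2 ^ S) * 2 ^ \<mu>) (\<lambda>\<tau> \<tau>'. peval (val \<tau> \<tau>') (transfer w L 0 0 (Suc j * b) k))"
      unfolding eq S_def \<mu>_def
      by (intro rank_le_sum rank_le_mult Suc.IH block) (use Suc.prems in \<open>auto simp: add.commute\<close>)
    moreover have "(\<Sum>i<w (j * b). (W ^ j * 2 ^ S) * 2 ^ \<mu>) \<le> W ^ Suc j * 2 ^ (\<Sum>j<Suc j. min (card (Y j)) (card (Z j)))"
      using W[OF jb] by (simp add: S_def[symmetric] \<mu>_def[symmetric] power_add)
    ultimately show ?case by (rule rank_le_mono)
  qed
  from this[of r 0] show ?thesis
    unfolding W_def abp_eval_transfer[of w m L, OF w01] using w01 by (simp add: m)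
qed

lemma imbalance_card:
  assumes "finite E"
  shows "imbalance E x y \<epsilon> j =
    int (card {e\<in>E. (e \<in> \<epsilon> \<and> x e = j) \<or> (e \<notin> \<epsilon> \<and> y e = j)}) - int (card {e\<in>E. (e \<in> \<epsilon> \<and> y e = j) \<or> (e \<notin> \<epsilon> \<and> x e = j)})"
proof -
  have c: "int (card {e\<in>E. Q e}) = (\<Sum>e\<in>E. of_bool (Q e))" for Q
    using assms by (simp add: of_bool_def sum.If_cases Int_def)
  show ?thesis
    unfolding c imbalance_def sum_subtractf[symmetric] by (intro sum.cong) auto
qed

text \<open>Sum 2 min(p, q) + |p - q| = p + q over the intervals: each edge has one row end and one
  column end, so rows and columns both total |E|.\<close>

lemma sum_min_imbalance:
  assumes E: "finite E" and x: "\<And>e. e \<in> E \<Longrightarrow> x e < r" and y: "\<And>e. e \<in> E \<Longrightarrow> y e < r"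
  shows "2 * (\<Sum>j<r. int (min (card {e\<in>E. (e \<in> \<epsilon> \<and> x e = j) \<or> (e \<notin> \<epsilon> \<and> y e = j)})
       (card {e\<in>E. (e \<in> \<epsilon> \<and> y e = j) \<or> (e \<notin> \<epsilon> \<and> x e = j)})))
    + (\<Sum>j<r. \<bar>imbalance E x y \<epsilon> j\<bar>) = 2 * int (card E)"
proof -
  have tot: "(\<Sum>j<r. int (card {e\<in>E. f e = j})) = int (card E)" if "\<And>e. e \<in> E \<Longrightarrow> f e < r" for f
  proof -
    have "E = (\<Union>j<r. {e\<in>E. f e = j})" using that by auto
    then have "card E = card (\<Union>j<r. {e\<in>E. f e = j})" by simp
    also have "\<dots> = (\<Sum>j<r. card {e\<in>E. f e = j})"
      by (rule card_UN_disjoint) (use E in auto)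
    finally show ?thesis by simp
  qed
  have if_eq: "((if c then p else q) = j) \<longleftrightarrow> (c \<and> p = j) \<or> (\<not> c \<and> q = j)" for c and p q j :: nat by auto
  have 1: "(\<Sum>j<r. int (card {e\<in>E. (e \<in> \<epsilon> \<and> x e = j) \<or> (e \<notin> \<epsilon> \<and> y e = j)})) = int (card E)"
  proof -
    have "(\<Sum>j<r. int (card {e\<in>E. (if e \<in> \<epsilon> then x e else y e) = j})) = int (card E)"
      by (rule tot) (use x y in auto)
    then show ?thesis by (simp only: if_eq)
  qed
  have 2: "(\<Sum>j<r. int (card {e\<in>E. (e \<in> \<epsilon> \<and> y e = j) \<or> (e \<notin> \<epsilon> \<and> x e = j)})) = int (card E)"
  proof -
    have "(\<Sum>j<r. int (card {e\<in>E. (if e \<in> \<epsilon> then y e else x e) = j})) = int (card E)"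
      by (rule tot) (use x y in auto)
    then show ?thesis by (simp only: if_eq)
  qed
  have "2 * int (min p q) + \<bar>int p - int q\<bar> = int p + int q" for p q by auto
  then show ?thesis
    unfolding imbalance_card[OF E] sum_distrib_left sum.distrib[symmetric] by (simp add: sum.distrib 1 2)
qed

section \<open>The hard polynomial\<close>

text \<open>Indices below \<open>b * k\<close> are the left buckets, the next \<open>b * k\<close>
  the right ones, both in consecutive runs of \<open>k\<close> per group and with \<open>D\<close>
  colours each; the last \<open>b\<close> are the selectors, with one variable per rotation.\<close>

definition buckets :: "nat \<Rightarrow> nat \<Rightarrow> nat \<Rightarrow> nat \<Rightarrow> nat set" where
  "buckets b k D i = (\<lambda>c. prod_encode (i, c)) ` {..<(if i < 2 * (b * k) then D else k)}"

definition colour_match :: "nat \<Rightarrow> nat \<Rightarrow> nat \<Rightarrow> 'a::comm_ring_1 mpoly" where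
  "colour_match D i j = (\<Sum>c<D. Var (prod_encode (i, c)) * Var (prod_encode (j, c)))"

definition hard_poly :: "nat \<Rightarrow> nat \<Rightarrow> nat \<Rightarrow> 'a::comm_ring_1 mpoly" where
  "hard_poly b k D = (\<Prod>g<b. \<Sum>a<k. Var (prod_encode (2 * (b * k) + g, a)) *
     (\<Prod>u<k. colour_match D (g * k + u) (b * k + (g * k + (u + a) mod k))))"

section \<open>Evaluation points and the identity matrix\<close>

text \<open>On a polynomial that is set-multilinear for the buckets, evaluation here extracts a
  coefficient: that of the monomial taking variable \<open>\<kappa> i\<close> from each bucket
  \<open>i\<close>, when all these variables exist. Coefficient matrices thus become matrices of
  values.\<close>

definition pick :: "(nat \<Rightarrow> nat) \<Rightarrow> nat \<Rightarrow> 'a::comm_ring_1" where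
  "pick \<kappa> v = (case prod_decode v of (i, c) \<Rightarrow> if c = \<kappa> i then 1 else 0)"

lemma pick_encode [simp]: "pick \<kappa> (prod_encode (i, c)) = (if c = \<kappa> i then 1 else 0)"
  by (simp add: pick_def)

lemma peval_colour_match:
  "peval (pick \<kappa>) (colour_match D i j) = (if \<kappa> i = \<kappa> j \<and> \<kappa> i < D then 1 else 0)"
proof -
  have "peval (pick \<kappa>) (colour_match D i j) = (\<Sum>c<D. if c = \<kappa> i then (if \<kappa> i = \<kappa> j then 1 else 0) else 0)"
    unfolding colour_match_def peval_sum peval_mult by (intro sum.cong) auto
  then show ?thesis by (auto split: if_splits)
qed

lemma prod_indicator:
  "finite A \<Longrightarrow> (\<Prod>i\<in>A. if Q i then 1 else 0) = (if \<forall>i\<in>A. Q i then 1 else (0::'a::comm_ring_1))"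
  by (induction A rule: finite_induct) auto

lemma peval_hard_poly:
  assumes "\<And>g. g < b \<Longrightarrow> \<kappa> (2 * (b * k) + g) < k"
  shows "peval (pick \<kappa>) (hard_poly b k D) =
    (if \<forall>g<b. \<forall>u<k. \<kappa> (g * k + u) = \<kappa> (b * k + (g * k + (u + \<kappa> (2 * (b * k) + g)) mod k)) \<and> \<kappa> (g * k + u) < D
     then 1 else 0)"
proof -
  have "peval (pick \<kappa>) (hard_poly b k D) = (\<Prod>g<b. \<Sum>a<k. if a = \<kappa> (2 * (b * k) + g) then
     (\<Prod>u<k. if \<kappa> (g * k + u) = \<kappa> (b * k + (g * k + (u + a) mod k)) \<and> \<kappa> (g * k + u) < D then 1 else 0) else 0)"
    unfolding hard_poly_def peval_prod peval_sum peval_mult peval_Var pick_encode peval_colour_match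
    by (intro prod.cong sum.cong refl) auto
  also have "\<dots> = (\<Prod>g<b. \<Prod>u<k. if \<kappa> (g * k + u) = \<kappa> (b * k + (g * k + (u + \<kappa> (2 * (b * k) + g)) mod k)) \<and> \<kappa> (g * k + u) < D then 1 else 0)"
    using assms by (intro prod.cong refl) simp
  also have "\<dots> = (\<Prod>g<b. if \<forall>u\<in>{..<k}. \<kappa> (g * k + u) = \<kappa> (b * k + (g * k + (u + \<kappa> (2 * (b * k) + g)) mod k)) \<and> \<kappa> (g * k + u) < D then 1 else 0)"
    by (simp only: prod_indicator[OF finite_lessThan])
  finally show ?thesis by (simp only: prod_indicator[OF finite_lessThan] Ball_def lessThan_iff)
qed

text \<open>The bucket colouring that selects the matchings \<open>a\<close> and gives the two ends of an edge \<open>e\<close> the colours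
  \<open>e \<in> \<tau>\<close> and \<open>e \<in> \<tau>'\<close>, in an order given by the orientation \<open>\<epsilon>\<close>.\<close>

definition colouring :: "nat \<Rightarrow> nat \<Rightarrow> (nat \<Rightarrow> nat) \<Rightarrow> (nat \<times> nat) set \<Rightarrow> (nat \<times> nat) set \<Rightarrow> (nat \<times> nat) set \<Rightarrow> nat \<Rightarrow> nat" where
  "colouring b k a \<epsilon> \<tau> \<tau>' i =
    (if i < b * k then
       (let e = (i div k, i mod k) in of_bool (e \<in> (if e \<in> \<epsilon> then \<tau> else \<tau>')))
     else if i < 2 * (b * k) then
       (let g = (i - b * k) div k; e = (g, ((i - b * k) mod k + (k - a g mod k)) mod k)
        in of_bool (e \<in> (if e \<in> \<epsilon> then \<tau>' else \<tau>)))
     else a (i - 2 * (b * k)))"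

lemma group_index_less: "g < b \<Longrightarrow> u < k \<Longrightarrow> g * k + u < b * (k::nat)"
proof -
  assume "g < b" "u < k"
  then have "g * k + u < Suc g * k" by simp
  also have "\<dots> \<le> b * k" using \<open>g < b\<close> by (intro mult_right_mono) auto
  finally show ?thesis .
qed

lemma colouring_left:
  assumes "g < b" "u < k"
  shows "colouring b k a \<epsilon> \<tau> \<tau>' (g * k + u) = of_bool ((g, u) \<in> (if (g, u) \<in> \<epsilon> then \<tau> else \<tau>'))"
  using group_index_less[OF assms] assms by (simp add: colouring_def)

lemma colouring_right:
  assumes "g < b" "u < k"
  shows "colouring b k a \<epsilon> \<tau> \<tau>' (b * k + (g * k + (u + a g) mod k)) = of_bool ((g, u) \<in> (if (g, u) \<in> \<epsilon> then \<tau>' else \<tau>))"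
proof -
  have lt: "(u + a g) mod k < k" using assms by simp
  have "((u + a g) mod k + (k - a g mod k)) mod k = u"
    using rotation_inverse[OF assms(2), of "a g"] by (simp only: add.commute)
  then show ?thesis
    using group_index_less[OF assms(1) lt] lt by (simp add: colouring_def Let_def)
qed

text \<open>The two ends of an edge have equal colours exactly when \<open>\<tau>\<close> and
  \<open>\<tau>'\<close> agree on it, whichever end is the row. So every choice of rotations and
  orientation gives the same identity matrix; \<open>D \<ge> 2\<close> provides the colours 0 and
  1.\<close>

lemma peval_colouring:
  assumes a: "a \<in> PiE {..<b} (\<lambda>_. {..<k})" and D: "D \<ge> 2"
    and \<tau>: "\<tau> \<subseteq> {..<b} \<times> {..<k}" "\<tau>' \<subseteq> {..<b} \<times> {..<k}"
  shows "peval (pick (colouring b k a \<epsilon> \<tau> \<tau>')) (hard_poly b k D) = (if \<tau> = \<tau>' then 1 else 0)"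
proof -
  have sel: "colouring b k a \<epsilon> \<tau> \<tau>' (2 * (b * k) + g) = a g" for g by (simp add: colouring_def)
  have "peval (pick (colouring b k a \<epsilon> \<tau> \<tau>')) (hard_poly b k D) =
    (if \<forall>g<b. \<forall>u<k. colouring b k a \<epsilon> \<tau> \<tau>' (g * k + u) = colouring b k a \<epsilon> \<tau> \<tau>' (b * k + (g * k + (u + a g) mod k)) \<and> colouring b k a \<epsilon> \<tau> \<tau>' (g * k + u) < D
     then 1 else 0)"
    by (subst peval_hard_poly) (use a in \<open>auto simp only: sel PiE_iff lessThan_iff\<close>)
  also have "(\<forall>g<b. \<forall>u<k. colouring b k a \<epsilon> \<tau> \<tau>' (g * k + u) = colouring b k a \<epsilon> \<tau> \<tau>' (b * k + (g * k + (u + a g) mod k)) \<and> colouring b k a \<epsilon> \<tau> \<tau>' (g * k + u) < D)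
      \<longleftrightarrow> (\<forall>g<b. \<forall>u<k. (g, u) \<in> \<tau> \<longleftrightarrow> (g, u) \<in> \<tau>')"
  proof (intro all_cong1 imp_cong refl)
    fix g u assume "g < b" "u < k"
    then show "(colouring b k a \<epsilon> \<tau> \<tau>' (g * k + u) = colouring b k a \<epsilon> \<tau> \<tau>' (b * k + (g * k + (u + a g) mod k)) \<and> colouring b k a \<epsilon> \<tau> \<tau>' (g * k + u) < D)
      = ((g, u) \<in> \<tau> \<longleftrightarrow> (g, u) \<in> \<tau>')"
      using D by (simp only: colouring_left colouring_right) (auto simp: of_bool_def)
  qed
  also have "\<dots> \<longleftrightarrow> \<tau> = \<tau>'" using \<tau> by auto
  finally show ?thesis .
qed

text \<open>\<open>pos\<close> sends a bucket to its interval. Rotations being onto, every bucket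
  other than a selector is an end of an edge, and its colour depends on that edge's membership in
  one of the two sets only; selectors depend on neither.\<close>

lemma colouring_local:
  fixes pos a :: "nat \<Rightarrow> nat" and b k :: nat and \<epsilon> :: "(nat \<times> nat) set"
  defines "x \<equiv> (\<lambda>e. pos (fst e * k + snd e))"
    and "y \<equiv> (\<lambda>e. pos (b * k + (fst e * k + (snd e + a (fst e)) mod k)))"
  assumes j: "pos i = j"
  shows "colouring b k a \<epsilon> \<tau> \<tau>' i
      = colouring b k a \<epsilon> (\<tau> \<inter> {e \<in> {..<b} \<times> {..<k}. (e \<in> \<epsilon> \<and> x e = j) \<or> (e \<notin> \<epsilon> \<and> y e = j)}) \<tau>' i"
    and "colouring b k a \<epsilon> \<tau> \<tau>' i
      = colouring b k a \<epsilon> \<tau> (\<tau>' \<inter> {e \<in> {..<b} \<times> {..<k}. (e \<in> \<epsilon> \<and> y e = j) \<or> (e \<notin> \<epsilon> \<and> x e = j)}) i"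
proof -
  consider (left) g u where "g < b" "u < k" "i = g * k + u"
    | (right) g u where "g < b" "u < k" "i = b * k + (g * k + (u + a g) mod k)"
    | (sel) "i \<ge> 2 * (b * k)"
  proof -
    have split: "\<exists>g u. g < b \<and> u < k \<and> i = g * k + u" if "i < b * k" for i
    proof (intro exI conjI)
      show "i div k < b" using that by (simp add: less_mult_imp_div_less)
      show "i mod k < k" using that by (cases "k = 0") auto
    qed simp
    show ?thesis
    proof (cases "i < b * k")
      case True
      then show ?thesis using split left by blast
    next
      case False
      show ?thesis
      proof (cases "i < 2 * (b * k)")
        case True
        then have "i - b * k < b * k" using False by linarith
        then obtain g v where gv: "g < b" "v < k" "i - b * k = g * k + v"
          using split[of "i - b * k"] False by auto
        obtain u where "u < k" "(a g + u) mod k = v"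
        proof -
          have "v \<in> (\<lambda>u. (a g + u) mod k) ` {..<k}"
            using bij_betw_imp_surj_on[OF bij_betw_rotation[of "a g" k]] gv(2) by simp
          then show ?thesis using that by auto
        qed
        then show ?thesis using right[of g u] gv False by (simp add: add.commute)
      qed (use sel in simp)
    qed
  qed
  then have "colouring b k a \<epsilon> \<tau> \<tau>' i
      = colouring b k a \<epsilon> (\<tau> \<inter> {e \<in> {..<b} \<times> {..<k}. (e \<in> \<epsilon> \<and> x e = j) \<or> (e \<notin> \<epsilon> \<and> y e = j)}) \<tau>' i
    \<and> colouring b k a \<epsilon> \<tau> \<tau>' i
      = colouring b k a \<epsilon> \<tau> (\<tau>' \<inter> {e \<in> {..<b} \<times> {..<k}. (e \<in> \<epsilon> \<and> y e = j) \<or> (e \<notin> \<epsilon> \<and> x e = j)}) i"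
  proof cases
    case left
    then have "x (g, u) = j" using j by (simp add: x_def)
    then show ?thesis using left by (simp add: colouring_left)
  next
    case right
    then have "y (g, u) = j" using j by (simp add: y_def)
    then show ?thesis using right by (simp add: colouring_right)
  qed (simp add: colouring_def)
  then show "colouring b k a \<epsilon> \<tau> \<tau>' i
      = colouring b k a \<epsilon> (\<tau> \<inter> {e \<in> {..<b} \<times> {..<k}. (e \<in> \<epsilon> \<and> x e = j) \<or> (e \<notin> \<epsilon> \<and> y e = j)}) \<tau>' i"
    and "colouring b k a \<epsilon> \<tau> \<tau>' i
      = colouring b k a \<epsilon> \<tau> (\<tau>' \<inter> {e \<in> {..<b} \<times> {..<k}. (e \<in> \<epsilon> \<and> y e = j) \<or> (e \<notin> \<epsilon> \<and> x e = j)}) i"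
    by blast+
qed

text \<open>\<open>inv \<sigma>\<close> gives the layer of a bucket. Distinct buckets occupy
  distinct layers, left and right ones included, and an interval has \<open>s\<close>
  layers.\<close>

lemma block_fibre_card:
  fixes b k :: nat
  assumes \<sigma>: "\<sigma> permutes {..<m}" and s: "s > 0"
  shows "card {e \<in> {..<b} \<times> {..<k}. inv \<sigma> (fst e * k + snd e) div s = j}
    + card {e \<in> {..<b} \<times> {..<k}. inv \<sigma> (b * k + (fst e * k + snd e)) div s = j} \<le> s"
proof -
  define l where "l e = inv \<sigma> (fst e * k + snd e)" for e :: "nat \<times> nat"
  define r where "r e = inv \<sigma> (b * k + (fst e * k + snd e))" for e :: "nat \<times> nat"
  define A where "A = {e \<in> {..<b} \<times> {..<k}. l e div s = j}"
  define B where "B = {e \<in> {..<b} \<times> {..<k}. r e div s = j}"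
  have inj\<sigma>: "inv \<sigma> p = inv \<sigma> q \<longleftrightarrow> p = q" for p q
    using permutes_inj[OF permutes_inv[OF \<sigma>]] by (auto dest: injD)
  have uniq: "e = e'" if "e \<in> {..<b} \<times> {..<k}" "e' \<in> {..<b} \<times> {..<k}" "fst e * k + snd e = fst e' * k + snd e'" for e e'
  proof -
    have "fst e = (fst e * k + snd e) div k" "snd e = (fst e * k + snd e) mod k"
      "fst e' = (fst e' * k + snd e') div k" "snd e' = (fst e' * k + snd e') mod k"
      using that(1,2) by auto
    then show ?thesis using that(3) by (metis prod.expand)
  qed
  have fin: "finite A" "finite B" by (simp_all add: A_def B_def)
  have "card A + card B = card (l ` A) + card (r ` B)"
  proof -
    have "inj_on l A"
    proof (rule inj_onI)
      fix e e' assume "e \<in> A" "e' \<in> A" "l e = l e'"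
      then show "e = e'" by (intro uniq) (auto simp: A_def l_def inj\<sigma>)
    qed
    moreover have "inj_on r B"
    proof (rule inj_onI)
      fix e e' assume "e \<in> B" "e' \<in> B" "r e = r e'"
      then show "e = e'" by (intro uniq) (auto simp: B_def r_def inj\<sigma>)
    qed
    ultimately show ?thesis by (simp add: card_image)
  qed
  also have "\<dots> = card (l ` A \<union> r ` B)"
  proof (rule card_Un_disjoint[symmetric])
    show "l ` A \<inter> r ` B = {}"
    proof (rule ccontr)
      assume "l ` A \<inter> r ` B \<noteq> {}"
      then obtain e e' where "e \<in> A" "e' \<in> B" "l e = r e'" by auto
      then have "fst e * k + snd e = b * k + (fst e' * k + snd e')" by (simp add: l_def r_def inj\<sigma>)
      moreover have "fst e * k + snd e < b * k" using \<open>e \<in> A\<close> by (auto simp: A_def intro!: group_index_less)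
      ultimately show False by simp
    qed
  qed (use fin in auto)
  also have "\<dots> \<le> card {j * s..<j * s + s}"
  proof (rule card_mono)
    have "p \<in> {j * s..<j * s + s}" if "p div s = j" for p
    proof -
      have "p div s * s + p mod s = p" "p mod s < s" using s by simp_all
      then show ?thesis unfolding that atLeastLessThan_iff by linarith
    qed
    then show "l ` A \<union> r ` B \<subseteq> {j * s..<j * s + s}" by (auto simp: A_def B_def)
  qed simp
  finally show ?thesis by (simp add: A_def B_def l_def r_def)
qed

section \<open>Set-multilinearity\<close>

text \<open>Arbitrary index sets allow factors living on disjoint groups of buckets to be
  multiplied.\<close>

definition set_multilinear_on :: "nat set \<Rightarrow> (nat \<Rightarrow> nat set) \<Rightarrow> 'a::zero mpoly \<Rightarrow> bool" where
  "set_multilinear_on I X P \<longleftrightarrow> (\<forall>\<mu>\<in>Poly_Mapping.keys P. Poly_Mapping.keys \<mu> \<subseteq> (\<Union>i\<in>I. X i) \<and>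
     (\<forall>i\<in>I. (\<Sum>v\<in>X i. Poly_Mapping.lookup \<mu> v) = 1))"

lemma set_multilinear_iff_on: "set_multilinear m X P \<longleftrightarrow> set_multilinear_on {..<m} X P"
  by (simp add: set_multilinear_def set_multilinear_on_def Ball_def)

lemma set_multilinear_on_one: "set_multilinear_on {} X 1"
  by (simp add: set_multilinear_on_def)

lemma set_multilinear_on_Var:
  assumes "v \<in> X i" "finite (X i)"
  shows "set_multilinear_on {i} X (Var v :: 'a::zero_neq_one mpoly)"
  using assms by (simp add: set_multilinear_on_def Var_def lookup_single when_def)

lemma set_multilinear_on_sum:
  assumes "\<And>a. a \<in> A \<Longrightarrow> set_multilinear_on I X (P a)"
  shows "set_multilinear_on I X (\<Sum>a\<in>A. P a :: 'a::comm_ring_1 mpoly)"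
  using assms
proof (induction A rule: infinite_finite_induct)
  case (insert a A)
  have "Poly_Mapping.keys (P a + (\<Sum>a\<in>A. P a)) \<subseteq> Poly_Mapping.keys (P a) \<union> Poly_Mapping.keys (\<Sum>a\<in>A. P a)"
    by (rule keys_add)
  moreover have "set_multilinear_on I X (P a)" "set_multilinear_on I X (\<Sum>a\<in>A. P a)"
    using insert by auto
  ultimately show ?case
    unfolding sum.insert[OF insert.hyps] set_multilinear_on_def by blast
qed (auto simp: set_multilinear_on_def)

lemma set_multilinear_on_mult:
  fixes P Q :: "'a::comm_ring_1 mpoly"
  assumes P: "set_multilinear_on I X P" and Q: "set_multilinear_on J X Q" and IJ: "I \<inter> J = {}"
    and X: "\<And>i j. i \<noteq> j \<Longrightarrow> X i \<inter> X j = {}"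
  shows "set_multilinear_on (I \<union> J) X (P * Q)"
  unfolding set_multilinear_on_def
proof
  fix \<mu> assume "\<mu> \<in> Poly_Mapping.keys (P * Q)"
  then obtain \<alpha> \<beta> where \<mu>: "\<mu> = \<alpha> + \<beta>" and \<alpha>: "\<alpha> \<in> Poly_Mapping.keys P" and \<beta>: "\<beta> \<in> Poly_Mapping.keys Q"
    using keys_mult[of P Q] by blast
  have a: "Poly_Mapping.keys \<alpha> \<subseteq> (\<Union>i\<in>I. X i)" "\<And>i. i \<in> I \<Longrightarrow> (\<Sum>v\<in>X i. Poly_Mapping.lookup \<alpha> v) = 1"
    using P \<alpha> by (auto simp: set_multilinear_on_def)
  have b: "Poly_Mapping.keys \<beta> \<subseteq> (\<Union>i\<in>J. X i)" "\<And>i. i \<in> J \<Longrightarrow> (\<Sum>v\<in>X i. Poly_Mapping.lookup \<beta> v) = 1"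
    using Q \<beta> by (auto simp: set_multilinear_on_def)
  have zero: "(\<Sum>v\<in>X i. Poly_Mapping.lookup \<nu> v) = 0"
    if "Poly_Mapping.keys \<nu> \<subseteq> (\<Union>i\<in>K. X i)" "i \<notin> K" for i K and \<nu> :: "nat \<Rightarrow>\<^sub>0 nat"
  proof (rule sum.neutral, rule ballI)
    fix v assume v: "v \<in> X i"
    have "v \<notin> X j" if "j \<in> K" for j using X[of i j] v that \<open>i \<notin> K\<close> by blast
    then show "Poly_Mapping.lookup \<nu> v = 0" using that(1) by (auto simp: in_keys_iff)
  qed
  show "Poly_Mapping.keys \<mu> \<subseteq> \<Union> (X ` (I \<union> J)) \<and> (\<forall>i\<in>I \<union> J. sum (Poly_Mapping.lookup \<mu>) (X i) = 1)"
  proof (intro conjI ballI)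
    show "Poly_Mapping.keys \<mu> \<subseteq> \<Union> (X ` (I \<union> J))"
      using a(1) b(1) keys_add[of \<alpha> \<beta>] unfolding \<mu> by blast
    fix i assume "i \<in> I \<union> J"
    then consider "i \<in> I" "i \<notin> J" | "i \<in> J" "i \<notin> I" using IJ by blast
    then show "sum (Poly_Mapping.lookup \<mu>) (X i) = 1"
      by cases (simp_all add: \<mu> lookup_add sum.distrib a(2) b(2) zero[OF a(1)] zero[OF b(1)])
  qed
qed

lemma set_multilinear_on_prod:
  fixes P :: "'b \<Rightarrow> 'a::comm_ring_1 mpoly"
  assumes "finite A" "\<And>g. g \<in> A \<Longrightarrow> set_multilinear_on (I g) X (P g)"
    and "\<And>g g'. g \<in> A \<Longrightarrow> g' \<in> A \<Longrightarrow> g \<noteq> g' \<Longrightarrow> I g \<inter> I g' = {}"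
    and X: "\<And>i j. i \<noteq> j \<Longrightarrow> X i \<inter> X j = {}"
  shows "set_multilinear_on (\<Union>g\<in>A. I g) X (\<Prod>g\<in>A. P g)"
  using assms(1-3)
proof (induction A rule: finite_induct)
  case (insert g A)
  have "I g \<inter> (\<Union>g\<in>A. I g) = {}" using insert.hyps(2) insert.prems(2) by blast
  then have "set_multilinear_on (I g \<union> (\<Union>g\<in>A. I g)) X (P g * (\<Prod>g\<in>A. P g))"
    using insert by (intro set_multilinear_on_mult X) auto
  then show ?case using insert.hyps by simp
qed (simp add: set_multilinear_on_one)

lemma group_index_eq_iff:
  assumes "u < k" "u' < (k::nat)"
  shows "g * k + u = g' * k + u' \<longleftrightarrow> g = g' \<and> u = u'"
proof
  assume eq: "g * k + u = g' * k + u'"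
  have "(g * k + u) div k = g" "(g' * k + u') div k = g'" "(g * k + u) mod k = u" "(g' * k + u') mod k = u'"
    using assms by auto
  then show "g = g' \<and> u = u'" using eq by metis
qed simp

lemma buckets_disjoint: "i \<noteq> j \<Longrightarrow> buckets b k D i \<inter> buckets b k D j = {}"
  by (auto simp: buckets_def)

lemma finite_buckets: "finite (buckets b k D i)"
  by (simp add: buckets_def)

lemma card_buckets: "card (buckets b k D i) = (if i < 2 * (b * k) then D else k)"
  by (simp add: buckets_def card_image inj_on_def)

lemma set_multilinear_hard_poly:
  "set_multilinear (2 * (b * k) + b) (buckets b k D) (hard_poly b k D :: 'a::comm_ring_1 mpoly)"
proof -
  let ?X = "buckets b k D"
  note disj = buckets_disjoint[of _ _ b k D]
  have match: "set_multilinear_on {i, j} ?X (colour_match D i j :: 'a mpoly)"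
    if "i < 2 * (b * k)" "j < 2 * (b * k)" "i \<noteq> j" for i j
    unfolding colour_match_def
  proof (rule set_multilinear_on_sum)
    fix c assume "c \<in> {..<D}"
    then have "set_multilinear_on ({i} \<union> {j}) ?X (Var (prod_encode (i, c)) * Var (prod_encode (j, c)) :: 'a mpoly)"
      by (intro set_multilinear_on_mult set_multilinear_on_Var finite_buckets disj)
        (use that in \<open>auto simp: buckets_def\<close>)
    then show "set_multilinear_on {i, j} ?X (Var (prod_encode (i, c)) * Var (prod_encode (j, c)) :: 'a mpoly)"
      by (simp add: insert_commute)
  qed
  define N where "N g = (\<lambda>u. g * k + u) ` {..<k} \<union> (\<lambda>u. b * k + (g * k + u)) ` {..<k}" for g
  have prod: "set_multilinear_on (N g) ?X (\<Prod>u<k. colour_match D (g * k + u) (b * k + (g * k + (u + a) mod k)) :: 'a mpoly)"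
    if g: "g < b" for g a
  proof -
    have gi: "g * k + u < b * k" "g * k + (u + a) mod k < b * k" if "u < k" for u
      using group_index_less[OF g that] group_index_less[OF g, of "(u + a) mod k" k] that by auto
    have "set_multilinear_on (\<Union>u\<in>{..<k}. {g * k + u, b * k + (g * k + (u + a) mod k)}) ?X
      (\<Prod>u<k. colour_match D (g * k + u) (b * k + (g * k + (u + a) mod k)) :: 'a mpoly)"
    proof (rule set_multilinear_on_prod)
      show "set_multilinear_on {g * k + u, b * k + (g * k + (u + a) mod k)} ?X
        (colour_match D (g * k + u) (b * k + (g * k + (u + a) mod k)) :: 'a mpoly)" if "u \<in> {..<k}" for u
        by (rule match) (use gi[of u] that in auto)
      show "{g * k + u, b * k + (g * k + (u + a) mod k)} \<inter> {g * k + u', b * k + (g * k + (u' + a) mod k)} = {}"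
        if "u \<in> {..<k}" "u' \<in> {..<k}" "u \<noteq> u'" for u u'
      proof -
        have "(u + a) mod k \<noteq> (u' + a) mod k"
          using inj_onD[OF bij_betw_imp_inj_on[OF bij_betw_rotation[of a k]], of u u'] that by (auto simp: add.commute)
        then show ?thesis using gi[of u] gi[of u'] that by auto
      qed
    qed (use disj in auto)
    \<comment> \<open>A rotation only permutes the right buckets of the group, so the index set is
      the same for all \<open>a\<close> and the terms of different rotations may be added.\<close>
    moreover have "(\<Union>u\<in>{..<k}. {g * k + u, b * k + (g * k + (u + a) mod k)}) = N g"
    proof -
      have "(\<lambda>u. b * k + (g * k + u)) ` {..<k} = (\<lambda>u. b * k + (g * k + u)) ` (\<lambda>u. (a + u) mod k) ` {..<k}"
        by (simp only: bij_betw_imp_surj_on[OF bij_betw_rotation])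
      then show ?thesis unfolding N_def by (auto simp: add.commute[of _ a])
    qed
    ultimately show ?thesis by simp
  qed
  have Nlt: "i < 2 * (b * k)" if i: "i \<in> N g" and g: "g < b" for i g
  proof -
    obtain u where u: "u < k" "i = g * k + u \<or> i = b * k + (g * k + u)" using i by (auto simp: N_def)
    then show ?thesis using group_index_less[OF g u(1)] by linarith
  qed
  have group: "set_multilinear_on ({2 * (b * k) + g} \<union> N g) ?X (\<Sum>a<k. Var (prod_encode (2 * (b * k) + g, a)) *
     (\<Prod>u<k. colour_match D (g * k + u) (b * k + (g * k + (u + a) mod k))) :: 'a mpoly)" if g: "g < b" for g
    by (intro set_multilinear_on_sum set_multilinear_on_mult set_multilinear_on_Var prod g disj finite_buckets)
      (use Nlt g in \<open>fastforce simp: buckets_def\<close>)+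
  have "set_multilinear_on (\<Union>g\<in>{..<b}. {2 * (b * k) + g} \<union> N g) ?X (hard_poly b k D :: 'a mpoly)"
    unfolding hard_poly_def
  proof (rule set_multilinear_on_prod)
    show "({2 * (b * k) + g} \<union> N g) \<inter> ({2 * (b * k) + g'} \<union> N g') = {}"
      if g: "g \<in> {..<b}" "g' \<in> {..<b}" "g \<noteq> g'" for g g'
    proof -
      have "b * k + (g * k + u) \<noteq> g' * k + u'" if "u < k" "u' < k" for u u'
        using group_index_less[of g' b u' k] g that by simp
      moreover have "b * k + (g' * k + u) \<noteq> g * k + u'" if "u < k" "u' < k" for u u'
        using group_index_less[of g b u' k] g that by simp
      ultimately have "N g \<inter> N g' = {}"
        using g by (auto simp: N_def group_index_eq_iff) metis+
      then show ?thesis using Nlt[of "2 * (b * k) + g" g'] Nlt[of "2 * (b * k) + g'" g] g by auto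
    qed
  qed (use group disj in auto)
  moreover have "(\<Union>g\<in>{..<b}. {2 * (b * k) + g} \<union> N g) = {..<2 * (b * k) + b}"
  proof
    show "(\<Union>g\<in>{..<b}. {2 * (b * k) + g} \<union> N g) \<subseteq> {..<2 * (b * k) + b}"
      using Nlt by fastforce
    have split: "\<exists>g<b. \<exists>u<k. i = g * k + u" if "i < b * k" for i
    proof (intro exI conjI)
      show "i div k < b" using that by (simp add: less_mult_imp_div_less)
      show "i mod k < k" using that by (cases "k = 0") auto
    qed simp
    show "{..<2 * (b * k) + b} \<subseteq> (\<Union>g\<in>{..<b}. {2 * (b * k) + g} \<union> N g)"
    proof
      fix i assume i: "i \<in> {..<2 * (b * k) + b}"
      consider "i < b * k" | "b * k \<le> i" "i - b * k < b * k" | "2 * (b * k) \<le> i" by linarith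
      then show "i \<in> (\<Union>g\<in>{..<b}. {2 * (b * k) + g} \<union> N g)"
      proof cases
        case 1
        then show ?thesis using split[of i] by (auto simp: N_def)
      next
        case 2
        from split[OF 2(2)] obtain g u where "g < b" "u < k" "i - b * k = g * k + u" by blast
        then have "i = b * k + (g * k + u)" using 2(1) by linarith
        then show ?thesis using \<open>g < b\<close> \<open>u < k\<close> by (auto simp: N_def)
      next
        case 3
        then have "i = 2 * (b * k) + (i - 2 * (b * k))" "i - 2 * (b * k) < b" using i by auto
        then show ?thesis by blast
      qed
    qed
  qed
  ultimately show ?thesis by (simp add: set_multilinear_iff_on)
qed

section \<open>Degree, number of variables and branching program size\<close>

lemma mono_deg_set_multilinear:
  assumes sm: "set_multilinear m X P" and X: "is_var_partition m X" and \<mu>: "\<mu> \<in> Poly_Mapping.keys P"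
  shows "mono_deg \<mu> = m"
proof -
  have "mono_deg \<mu> = (\<Sum>v\<in>(\<Union>i<m. X i). Poly_Mapping.lookup \<mu> v)"
    unfolding mono_deg_def using sm \<mu> X
    by (intro sum.mono_neutral_left) (auto simp: set_multilinear_def is_var_partition_def in_keys_iff)
  also have "\<dots> = (\<Sum>i<m. \<Sum>v\<in>X i. Poly_Mapping.lookup \<mu> v)"
    using X by (intro sum.UNION_disjoint) (auto simp: is_var_partition_def)
  also have "\<dots> = m" using sm \<mu> by (simp add: set_multilinear_def)
  finally show ?thesis .
qed

lemma buckets_var_partition: "is_var_partition m (buckets b k D)"
  by (simp add: is_var_partition_def finite_buckets buckets_disjoint)

text \<open>With colour \<open>c\<close> everywhere and rotation 0 in every group the polynomial
  takes the value 1, so some monomial is nonzero at this point. It has one variable from each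
  bucket, which must then be the one of colour \<open>c\<close>. No coefficient is computed; both
  the exact degree and the lower bound on the number of variables follow.\<close>

lemma hard_poly_key:
  assumes k: "k > 0" and c: "c < D"
  obtains \<mu> where "\<mu> \<in> Poly_Mapping.keys (hard_poly b k D :: 'a::field mpoly)"
    "\<And>i. i < 2 * (b * k) \<Longrightarrow> prod_encode (i, c) \<in> Poly_Mapping.keys \<mu>"
proof -
  define \<kappa> where "\<kappa> i = (if i < 2 * (b * k) then c else 0)" for i
  have "peval (pick \<kappa>) (hard_poly b k D :: 'a mpoly) = 1"
  proof (subst peval_hard_poly)
    have "\<kappa> (g * k + u) = c" "\<kappa> (b * k + (g * k + (u + v) mod k)) = c" if "g < b" "u < k" for g u v
      using group_index_less[OF that] group_index_less[of g b "(u + v) mod k" k] that by (simp_all add: \<kappa>_def)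
    then show "(if \<forall>g<b. \<forall>u<k. \<kappa> (g * k + u) = \<kappa> (b * k + (g * k + (u + \<kappa> (2 * (b * k) + g)) mod k)) \<and> \<kappa> (g * k + u) < D
     then 1 else (0::'a)) = 1" using c by simp
  qed (simp add: \<kappa>_def k)
  then have "(\<Sum>\<mu>\<in>Poly_Mapping.keys (hard_poly b k D :: 'a mpoly). Poly_Mapping.lookup (hard_poly b k D) \<mu> * mono_eval (pick \<kappa>) \<mu>) \<noteq> (0::'a)"
    by (simp add: peval_def)
  then obtain \<mu> where \<mu>: "\<mu> \<in> Poly_Mapping.keys (hard_poly b k D :: 'a mpoly)" "mono_eval (pick \<kappa>) \<mu> \<noteq> (0::'a)"
    by (metis (no_types, lifting) mult_zero_right sum.neutral)
  have "prod_encode (i, c) \<in> Poly_Mapping.keys \<mu>" if i: "i < 2 * (b * k)" for i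
  proof -
    have "(\<Sum>v\<in>buckets b k D i. Poly_Mapping.lookup \<mu> v) = 1"
      using set_multilinear_hard_poly[of b k D, where 'a = 'a] \<mu>(1) i by (simp add: set_multilinear_def)
    then obtain v where v: "v \<in> buckets b k D i" "Poly_Mapping.lookup \<mu> v \<noteq> 0"
      by (metis sum.neutral zero_neq_one)
    then have key: "v \<in> Poly_Mapping.keys \<mu>" by (simp add: in_keys_iff)
    then have "pick \<kappa> v ^ Poly_Mapping.lookup \<mu> v \<noteq> (0::'a)"
      using \<mu>(2) unfolding mono_eval_def by (simp add: prod_zero_iff)
    then have "pick \<kappa> v \<noteq> (0::'a)" using v(2) by (simp add: power_0_left)
    moreover obtain c' where "v = prod_encode (i, c')" using v(1) by (auto simp: buckets_def)
    ultimately have "v = prod_encode (i, c)" using i by (simp add: \<kappa>_def split: if_splits)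
    then show ?thesis using key by simp
  qed
  then show ?thesis using that \<mu>(1) by blast
qed

lemma total_degree_hard_poly:
  assumes "k > 0" "D > 0"
  shows "total_degree (hard_poly b k D :: 'a::field mpoly) = 2 * (b * k) + b"
proof -
  obtain \<mu> where \<mu>: "\<mu> \<in> Poly_Mapping.keys (hard_poly b k D :: 'a mpoly)"
    using hard_poly_key[OF assms, where 'a = 'a] by blast
  have "mono_deg ` Poly_Mapping.keys (hard_poly b k D :: 'a mpoly) = {2 * (b * k) + b}"
    using mono_deg_set_multilinear[OF set_multilinear_hard_poly[where 'a = 'a] buckets_var_partition] \<mu> by auto
  then show ?thesis by (simp add: total_degree_def)
qed

lemma card_vars_hard_poly:
  assumes "k > 0"
  shows "2 * (b * k) * D \<le> card (vars (hard_poly b k D :: 'a::field mpoly))"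
    and "card (vars (hard_poly b k D :: 'a::field mpoly)) \<le> 2 * (b * k) * D + b * k"
proof -
  let ?V = "vars (hard_poly b k D :: 'a mpoly)"
  have sub: "?V \<subseteq> (\<Union>i<2 * (b * k) + b. buckets b k D i)"
    using set_multilinear_hard_poly[of b k D, where 'a = 'a] unfolding set_multilinear_def vars_def by blast
  have fin: "finite (\<Union>i<2 * (b * k) + b. buckets b k D i)" by (simp add: finite_buckets)
  have "prod_encode ` ({..<2 * (b * k)} \<times> {..<D}) \<subseteq> ?V"
  proof
    fix v assume "v \<in> prod_encode ` ({..<2 * (b * k)} \<times> {..<D})"
    then obtain i c where v: "v = prod_encode (i, c)" "i < 2 * (b * k)" "c < D" by auto
    obtain \<mu> where "\<mu> \<in> Poly_Mapping.keys (hard_poly b k D :: 'a mpoly)"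
      "\<And>i. i < 2 * (b * k) \<Longrightarrow> prod_encode (i, c) \<in> Poly_Mapping.keys \<mu>"
      using hard_poly_key[OF assms v(3), where 'a = 'a] by blast
    then show "v \<in> ?V" unfolding vars_def v(1) using v(2) by blast
  qed
  then have "card (prod_encode ` ({..<2 * (b * k)} \<times> {..<D})) \<le> card ?V"
    by (rule card_mono[OF finite_subset[OF sub fin]])
  then show "2 * (b * k) * D \<le> card ?V"
    by (subst (asm) card_image) (auto intro: inj_on_subset[OF inj_prod_encode])
  have split: "(\<Sum>i<p + q. f i) = (\<Sum>i<p. f i) + (\<Sum>i<q. f (p + i))" for f :: "nat \<Rightarrow> nat" and p q
    by (induction q) (auto simp: add.assoc)
  have "card ?V \<le> card (\<Union>i<2 * (b * k) + b. buckets b k D i)" by (rule card_mono[OF fin sub])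
  also have "\<dots> \<le> (\<Sum>i<2 * (b * k) + b. card (buckets b k D i))" by (rule card_UN_le) simp
  also have "\<dots> = (\<Sum>i<2 * (b * k). card (buckets b k D i)) + (\<Sum>i<b. card (buckets b k D (2 * (b * k) + i)))"
    by (simp only: split)
  also have "\<dots> = 2 * (b * k) * D + b * k" by (simp add: card_buckets)
  finally show "card ?V \<le> 2 * (b * k) * D + b * k" .
qed

text \<open>A group takes one layer for the selector, four for each of the k inner products (two
  factors and two for the sum over colours) and two for the sum over rotations. The width grows to D
  by the sum over colours and to kD by the sum over rotations; groups are concatenated.\<close>

lemma width_computable_hard_poly:
  assumes "k > 0" "D > 0"
  shows "width_computable (k * D) (b * (4 * k + 3)) (hard_poly b k D)"
  unfolding hard_poly_def
proof (rule width_computable_prod)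
  fix g
  have match: "width_computable (D * 1) (2 + 2) (colour_match D i j :: 'a mpoly)" for i j
    unfolding colour_match_def
  proof (rule width_computable_sum)
    fix c
    have "width_computable 1 (1 + 1) (Var (prod_encode (i, c)) * Var (prod_encode (j, c)) :: 'a mpoly)"
      by (intro width_computable_mult width_computable_linear) auto
    then show "width_computable 1 2 (Var (prod_encode (i, c)) * Var (prod_encode (j, c)) :: 'a mpoly)"
      by (simp only: one_add_one)
  qed simp
  have "width_computable (k * D) ((1 + k * 4) + 2) (\<Sum>a<k. Var (prod_encode (2 * (b * k) + g, a)) *
     (\<Prod>u<k. colour_match D (g * k + u) (b * k + (g * k + (u + a) mod k))) :: 'a mpoly)"
    by (intro width_computable_sum width_computable_mult width_computable_linear width_computable_prod)
      (use match assms in auto)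
  moreover have "(1 + k * 4) + 2 = 4 * k + 3" by simp
  ultimately show "width_computable (k * D) (4 * k + 3) (\<Sum>a<k. Var (prod_encode (2 * (b * k) + g, a)) *
     (\<Prod>u<k. colour_match D (g * k + u) (b * k + (g * k + (u + a) mod k))) :: 'a mpoly)"
    by (simp only:)
qed (use assms in simp)

section \<open>The lower bound\<close>

lemma sum_power_le: "r > 0 \<Longrightarrow> finite A \<Longrightarrow> (\<Sum>i\<in>A. w i ^ r) \<le> (\<Sum>i\<in>A. w i :: nat) ^ r"
proof -
  assume r: "r > 0" and A: "finite A"
  have "(\<Sum>i\<in>A. w i ^ r) = (\<Sum>i\<in>A. w i * w i ^ (r - 1))"
    using r by (intro sum.cong refl) (simp add: power_eq_if)
  also have "\<dots> \<le> (\<Sum>i\<in>A. w i * (\<Sum>i\<in>A. w i) ^ (r - 1))"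
    using A by (intro sum_mono mult_left_mono power_mono member_le_sum) auto
  also have "\<dots> = (\<Sum>i\<in>A. w i) ^ r"
    using r by (simp add: sum_distrib_right[symmetric] power_eq_if)
  finally show ?thesis .
qed

text \<open>An identity matrix of size 2^(bk) is a sum of matrices of rank at most w_i^r 2^(S i),
  where S i <= bk - q' h. Cancelling 2^(bk) gives 2^(q' h) <= W^r; the 66th power in the conclusion
  avoids roots.\<close>

lemma total_width_lower_bound:
  fixes As :: "'a::field smabp list"
  assumes h: "h > 0" and b: "b = 32768 * h\<^sup>2" and k: "k = 16 * b" and D: "D \<ge> 2"
    and m: "m = 2 * (b * k) + b"
    and comp: "sum_smabp_computes m (buckets b k D) As (hard_poly b k D)"
  shows "2 ^ h \<le> total_width m As ^ 66"
proof -
  define W where "W = total_width m As"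
  define I where "I = {..<length As}"
  define \<sigma> where "\<sigma> i = fst (As ! i)" for i
  define w where "w i = fst (snd (As ! i))" for i
  define L where "L i = snd (snd (As ! i))" for i
  define E where "E = {..<b} \<times> {..<k}"
  define r where "r = 32 * b + 1"
  define q' where "q' = 16384 * h\<^sup>2"
  have bq: "b = 2 * q'" by (simp add: b q'_def)
  have b0: "b > 0" and q0: "q' > 0" using b h by (simp_all add: q'_def)
  have mr: "m = r * b" by (simp add: m k r_def algebra_simps)
  have r33: "r \<le> 33 * b" using b0 by (simp add: r_def)
  have nth: "As ! i = (\<sigma> i, w i, L i)" for i by (simp add: \<sigma>_def w_def L_def)
  have sm: "is_smabp m (buckets b k D) (\<sigma> i) (w i) (L i)" if "i \<in> I" for i
    using comp that nth_mem[of i As] unfolding sum_smabp_computes_def I_def by (auto simp: nth)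
  have P: "hard_poly b k D = (\<Sum>i\<in>I. abp_eval m (w i) (L i))"
    using comp by (simp add: sum_smabp_computes_def sum_list_sum_nth I_def nth lessThan_atLeast0)
  have W: "W = (\<Sum>i\<in>I. abp_width m (w i))"
    by (simp add: W_def total_width_def sum_list_sum_nth I_def nth lessThan_atLeast0)
  have w1: "1 \<le> abp_width m (w i)" if "i \<in> I" for i
  proof -
    have "w i 0 \<le> abp_width m (w i)" unfolding abp_width_def by (rule Max_ge) auto
    then show ?thesis using sm[OF that] by (simp add: is_smabp_def)
  qed
  have finE: "finite E" and cardE: "card E = b * k" by (simp_all add: E_def)
  show ?thesis
  proof (cases "2 * card I < 2 ^ q'")
    \<comment> \<open>There are at least 2^(q' - 1) programs, each of width at least 1, and h <= q'
      - 1.\<close>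
    case False
    have "card I = (\<Sum>i\<in>I. 1)" by simp
    also have "\<dots> \<le> W" unfolding W by (intro sum_mono w1)
    finally have "2 ^ q' \<le> 2 * W" using False by linarith
    moreover have "q' = Suc (q' - 1)" using q0 by simp
    ultimately have "2 ^ (q' - 1) \<le> W" by (metis mult_le_cancel1 power_Suc zero_less_numeral)
    moreover have "h \<le> q' - 1" using h by (simp add: q'_def power2_eq_square) (cases h; simp)
    then have "(2::nat) ^ h \<le> 2 ^ (q' - 1)" by (intro power_increasing) auto
    ultimately have "2 ^ h \<le> W" by linarith
    moreover have "1 \<le> W" using \<open>2 ^ h \<le> W\<close> one_le_power[of "2::nat" h] by linarith
    then have "W \<le> W ^ 66" by (rule self_le_power) simp
    ultimately show ?thesis unfolding W_def by linarith
  next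
    case True
    define pos where "pos i v = inv (\<sigma> i) v div b" for i v
    have perm: "\<sigma> i permutes {..<m}" if "i \<in> I" for i using sm[OF that] by (simp add: is_smabp_def)
    have posr: "pos i v < r" if "i \<in> I" "v < m" for i v
    proof -
      have "inv (\<sigma> i) v < r * b" using permutes_in_image[OF permutes_inv[OF perm[OF that(1)]]] that(2) by (simp add: mr)
      then show ?thesis by (simp add: pos_def less_mult_imp_div_less)
    qed
    have eb: "g * k + u < m" "b * k + (g * k + u) < m" if "g < b" "u < k" for g u
      using group_index_less[OF that] by (simp_all add: m)
    obtain a \<epsilon> where a: "a \<in> PiE {..<b} (\<lambda>_. {..<k})"
      and imb: "\<And>i. i \<in> I \<Longrightarrow> int (b * h) \<le> (\<Sum>j<r. \<bar>imbalance ({..<b} \<times> {..<k})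
        (\<lambda>e. pos i (fst e * k + snd e)) (\<lambda>e. pos i (b * k + (fst e * k + (snd e + a (fst e)) mod k))) \<epsilon> j\<bar>)"
    proof (rule exists_unbalanced[OF h b k r33, of I "\<lambda>i g u. pos i (g * k + u)" "\<lambda>i g u. pos i (b * k + (g * k + u))"])
      show "finite I" by (simp add: I_def)
      show "2 * card I < 2 ^ (16384 * h\<^sup>2)" using True by (simp add: q'_def)
      show "card {e \<in> {..<b} \<times> {..<k}. pos i (fst e * k + snd e) = j}
        + card {e \<in> {..<b} \<times> {..<k}. pos i (b * k + (fst e * k + snd e)) = j} \<le> b" if "i \<in> I" for i j
        unfolding pos_def by (rule block_fibre_card[OF perm[OF that] b0])
    qed (use posr eb in auto)
    define x where "x i = (\<lambda>e. pos i (fst e * k + snd e))" for i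
    define y where "y i = (\<lambda>e. pos i (b * k + (fst e * k + (snd e + a (fst e)) mod k)))" for i
    define Y where "Y i j = {e\<in>E. (e \<in> \<epsilon> \<and> x i e = j) \<or> (e \<notin> \<epsilon> \<and> y i e = j)}" for i j
    define Z where "Z i j = {e\<in>E. (e \<in> \<epsilon> \<and> y i e = j) \<or> (e \<notin> \<epsilon> \<and> x i e = j)}" for i j
    define S where "S i = (\<Sum>j<r. min (card (Y i j)) (card (Z i j)))" for i
    define val :: "(nat \<times> nat) set \<Rightarrow> (nat \<times> nat) set \<Rightarrow> nat \<Rightarrow> 'a"
      where "val \<tau> \<tau>' = pick (colouring b k a \<epsilon> \<tau> \<tau>')" for \<tau> \<tau>'
    have k0: "k > 0" using k b0 by simp
    have Sle: "S i + q' * h \<le> b * k" if i: "i \<in> I" for i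
    proof -
      have "2 * (\<Sum>j<r. int (min (card (Y i j)) (card (Z i j)))) + (\<Sum>j<r. \<bar>imbalance E (x i) (y i) \<epsilon> j\<bar>) = 2 * int (card E)"
        unfolding Y_def Z_def
      proof (rule sum_min_imbalance[OF finE])
        show "x i e < r" if "e \<in> E" for e using that i posr eb by (auto simp: E_def x_def)
        show "y i e < r" if "e \<in> E" for e using that i posr eb k0 by (auto simp: E_def y_def)
      qed
      moreover have "int (b * h) \<le> (\<Sum>j<r. \<bar>imbalance E (x i) (y i) \<epsilon> j\<bar>)"
        using imb[OF i] by (simp add: E_def x_def y_def)
      moreover have "(\<Sum>j<r. int (min (card (Y i j)) (card (Z i j)))) = int (S i)" by (simp add: S_def)
      ultimately have "2 * int (S i) + int (b * h) \<le> 2 * int (b * k)" using cardE by linarith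
      then have "int (2 * S i + b * h) \<le> int (2 * (b * k))" by simp
      then have "2 * S i + b * h \<le> 2 * (b * k)" by (simp only: of_nat_le_iff)
      then show ?thesis unfolding bq by (simp add: mult.assoc)
    qed
    have rank: "rank_le (abp_width m (w i) ^ r * 2 ^ S i) (\<lambda>\<tau> \<tau>'. peval (val \<tau> \<tau>') (abp_eval m (w i) (L i)))"
      if i: "i \<in> I" for i
      unfolding S_def
    proof (rule smabp_rank_le[OF sm[OF i] mr])
      show "finite (Y i j)" "finite (Z i j)" for j using finE by (simp_all add: Y_def Z_def)
      fix l v \<tau> \<tau>' assume l: "l < m" and v: "v \<in> buckets b k D (\<sigma> i l)"
      then obtain c where c: "v = prod_encode (\<sigma> i l, c)" by (auto simp: buckets_def)
      have "inv (\<sigma> i) (\<sigma> i l) = l" using perm[OF i] by (simp add: permutes_inverses)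
      then have p: "pos i (\<sigma> i l) = l div b" by (simp add: pos_def)
      have Yeq: "Y i (l div b) = {e \<in> {..<b} \<times> {..<k}. (e \<in> \<epsilon> \<and> pos i (fst e * k + snd e) = l div b)
          \<or> (e \<notin> \<epsilon> \<and> pos i (b * k + (fst e * k + (snd e + a (fst e)) mod k)) = l div b)}"
        and Zeq: "Z i (l div b) = {e \<in> {..<b} \<times> {..<k}. (e \<in> \<epsilon> \<and> pos i (b * k + (fst e * k + (snd e + a (fst e)) mod k)) = l div b)
          \<or> (e \<notin> \<epsilon> \<and> pos i (fst e * k + snd e) = l div b)}"
        by (simp_all only: Y_def Z_def E_def x_def y_def)
      note loc = colouring_local[where pos = "pos i", OF p, of b k a \<epsilon> \<tau> \<tau>', folded Yeq Zeq]
      show "val \<tau> \<tau>' v = val (\<tau> \<inter> Y i (l div b)) \<tau>' v"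
        unfolding val_def c pick_encode using loc(1) by (simp only:)
      show "val \<tau> \<tau>' v = val \<tau> (\<tau>' \<inter> Z i (l div b)) v"
        unfolding val_def c pick_encode using loc(2) by (simp only:)
    qed
    have "rank_le (\<Sum>i\<in>I. abp_width m (w i) ^ r * 2 ^ S i) (\<lambda>\<tau> \<tau>'. peval (val \<tau> \<tau>') (hard_poly b k D))"
      unfolding P peval_sum by (rule rank_le_sum) (use rank in \<open>auto simp: I_def\<close>)
    then have "card (Pow E) \<le> (\<Sum>i\<in>I. abp_width m (w i) ^ r * 2 ^ S i)"
    proof (rule rank_le_identity)
      show "peval (val \<tau> \<tau>') (hard_poly b k D) = (if \<tau> = \<tau>' then 1 else 0)" if "\<tau> \<in> Pow E" "\<tau>' \<in> Pow E" for \<tau> \<tau>'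
        unfolding val_def by (rule peval_colouring[OF a D]) (use that in \<open>auto simp: E_def\<close>)
    qed (use finE in simp)
    then have "2 ^ (b * k) * 2 ^ (q' * h) \<le> (\<Sum>i\<in>I. abp_width m (w i) ^ r * 2 ^ S i) * 2 ^ (q' * h)"
      using finE cardE by (simp add: card_Pow)
    also have "\<dots> = (\<Sum>i\<in>I. abp_width m (w i) ^ r * 2 ^ (S i + q' * h))"
      by (simp add: sum_distrib_right power_add mult.assoc)
    also have "\<dots> \<le> (\<Sum>i\<in>I. abp_width m (w i) ^ r * 2 ^ (b * k))"
      by (intro sum_mono mult_left_mono power_increasing Sle) auto
    also have "\<dots> = (\<Sum>i\<in>I. abp_width m (w i) ^ r) * 2 ^ (b * k)" by (simp add: sum_distrib_right)
    \<comment> \<open>The r-th power is superadditive, so only the total width remains.\<close>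
    also have "\<dots> \<le> W ^ r * 2 ^ (b * k)"
      unfolding W by (intro mult_right_mono sum_power_le) (auto simp: r_def I_def)
    finally have "2 ^ (q' * h) \<le> W ^ r" by (simp add: mult.commute)
    moreover have "W > 0"
    proof (rule ccontr)
      assume "\<not> W > 0"
      then have "W ^ r = 0" by (simp add: r_def)
      with \<open>2 ^ (q' * h) \<le> W ^ r\<close> show False by simp
    qed
    \<comment> \<open>As 33 b = 66 q', both exponents have the factor q' and the q'-th root can be
      taken.\<close>
    then have "W ^ r \<le> W ^ (33 * b)" using r33 by (intro power_increasing) auto
    moreover have "(2::nat) ^ (q' * h) = (2 ^ h) ^ q'" by (simp add: power_mult[symmetric] mult.commute)
    moreover have "W ^ (33 * b) = (W ^ 66) ^ q'" by (simp add: bq power_mult[symmetric])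
    ultimately have "(2 ^ h) ^ q' \<le> (W ^ 66) ^ q'" by simp
    then show ?thesis using q0 unfolding W_def by (simp only: power_mono_iff)
  qed
qed

section \<open>Choice of parameters\<close>

text \<open>Adding one to the floor keeps h at least n^(1/4) and makes it positive even for n =
  0.\<close>

definition hard_h :: "nat \<Rightarrow> nat" where "hard_h n = Suc (nat \<lfloor>real n powr (1/4)\<rfloor>)"

text \<open>The constant makes the threshold \<open>1024 h\<^sup>2\<close> of \<open>sign_sum_small_card\<close> equal to \<open>b / 32\<close>, so that intervals
  with fewer fresh edges carry at most half of the \<open>4 b\<^sup>2\<close> edges that join different intervals.\<close>

definition hard_b :: "nat \<Rightarrow> nat" where "hard_b n = 32768 * (hard_h n)\<^sup>2"

lemma hard_h_bounds:
  "real n powr (1/4) \<le> real (hard_h n)" "real (hard_h n) \<le> real n powr (1/4) + 1"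
  unfolding hard_h_def by (simp_all add: of_nat_nat) linarith+

lemma hard_b_pos: "hard_b n > 0"
  by (simp add: hard_b_def hard_h_def)

lemma hard_b_real: "real (hard_b n) = 32768 * (real (hard_h n))\<^sup>2"
  by (simp add: hard_b_def)

lemma powr_quarter_pow4: "(real n powr (1/4)) ^ 4 = real n"
  by (cases "n = 0") (simp_all add: powr_realpow[symmetric] powr_powr)

text \<open>Here b^2 = 2^30 h^4, and h lies between x and x + 1 <= 2x for x = n^(1/4), whence the
  constant 2^30 times 2^4. The degree, being 32 b^2 + b, is therefore of order n.\<close>

lemma hard_b_sq_bounds:
  assumes "n \<ge> 1"
  shows "real n \<le> (real (hard_b n))\<^sup>2" "(real (hard_b n))\<^sup>2 \<le> 2 ^ 34 * real n"
proof -
  let ?x = "real n powr (1/4)"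
  have "1 \<le> ?x" using assms by (simp add: ge_one_powr_ge_zero)
  have sq: "(real (hard_b n))\<^sup>2 = 2 ^ 30 * real (hard_h n) ^ 4"
    by (simp add: hard_b_real power_mult_distrib flip: power_mult)
  have "real n = ?x ^ 4" by (rule powr_quarter_pow4[symmetric])
  also have "\<dots> \<le> real (hard_h n) ^ 4" by (intro power_mono hard_h_bounds) simp
  also have "\<dots> \<le> 2 ^ 30 * real (hard_h n) ^ 4" by simp
  finally show "real n \<le> (real (hard_b n))\<^sup>2" unfolding sq .
  have "real (hard_h n) ^ 4 \<le> (2 * ?x) ^ 4"
    using hard_h_bounds(2)[of n] \<open>1 \<le> ?x\<close> by (intro power_mono) auto
  also have "\<dots> = 16 * real n" by (simp add: power_mult_distrib powr_quarter_pow4)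
  finally show "(real (hard_b n))\<^sup>2 \<le> 2 ^ 34 * real n" unfolding sq by simp
qed

lemma hard_b_le: "hard_b n \<le> 32768 * (n + 1)\<^sup>2"
proof -
  have "real n powr (1/4) \<le> real n"
  proof (cases "n = 0")
    case False
    then have "real n powr (1/4) \<le> real n powr 1" by (intro powr_mono) auto
    then show ?thesis by simp
  qed simp
  then have "real (hard_h n) \<le> real (n + 1)" using hard_h_bounds(2)[of n] by simp
  then have "hard_h n \<le> n + 1" by (simp only: of_nat_le_iff)
  then show ?thesis unfolding hard_b_def by (intro mult_left_mono power_mono) auto
qed

lemma polynomial_bound_form:
  fixes f :: nat
  assumes "f \<le> C * (n + 1) ^ e" "c \<ge> C * 2 ^ e" "c \<ge> e"
  shows "f \<le> c * n ^ c + c"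
proof (cases "n = 0")
  case True
  have "f \<le> C" using assms(1) True by simp
  also have "C \<le> C * 2 ^ e" by simp
  also note assms(2)
  finally show ?thesis by simp
next
  case False
  have "f \<le> C * (2 * n) ^ e"
    using False by (intro order_trans[OF assms(1)] mult_left_mono power_mono) auto
  also have "\<dots> = (C * 2 ^ e) * n ^ e" by (simp add: power_mult_distrib)
  also have "\<dots> \<le> c * n ^ c"
    using False assms by (intro mult_mono power_increasing) auto
  finally show ?thesis by simp
qed

lemma hard_poly_in_VBP:
  "in_VBP (\<lambda>n. hard_poly (hard_b n) (16 * hard_b n) (n + 2) :: 'a::field mpoly)"
proof -
  \<comment> \<open>The program size is at most b (8k) (kD) = 2048 b^3 D, and b^3 D <= 2 * 32768^3
    (n + 1)^7.\<close>
  define C :: nat where "C = 4096 * 32768 ^ 3"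
  define c where "c = C * 2 ^ 7 + 7"
  show ?thesis
    unfolding in_VBP_def
  proof (rule exI[of _ c], intro allI conjI)
    fix n
    define b where "b = hard_b n"
    define k where "k = 16 * b"
    define D where "D = n + 2"
    have b: "b > 0" using hard_b_pos by (simp add: b_def)
    have k: "k > 0" using b by (simp add: k_def)
    have D: "D > 0" by (simp add: D_def)
    have b3: "b ^ 3 * D \<le> 32768 ^ 3 * 2 * (n + 1) ^ 7"
    proof -
      have "b ^ 3 * D \<le> (32768 * (n + 1)\<^sup>2) ^ 3 * (2 * (n + 1))"
        unfolding b_def D_def by (intro mult_mono power_mono hard_b_le) auto
      also have "\<dots> = 32768 ^ 3 * 2 * ((n + 1) ^ 6 * (n + 1))"
        by (simp add: power_mult_distrib flip: power_mult)
      also have "(n + 1) ^ 6 * (n + 1) = (n + 1) ^ 7" by (simp add: eval_nat_numeral)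
      finally show ?thesis .
    qed
    have b1: "b \<le> b * b" "b * b \<le> b ^ 3 * D" "1 \<le> b * b * b * D" using b D by (simp_all add: power3_eq_cube)
    have "total_degree (hard_poly b k D :: 'a mpoly) = 2 * (b * k) + b"
      by (rule total_degree_hard_poly[OF k D])
    also have "\<dots> \<le> 33 * (b * b)" using b1(1) by (simp add: k_def)
    also have "\<dots> \<le> 33 * (b ^ 3 * D)" using b1(2) by simp
    also have "\<dots> \<le> C * (n + 1) ^ 7" using b3 by (simp add: C_def)
    finally show "total_degree (hard_poly (hard_b n) (16 * hard_b n) (n + 2) :: 'a mpoly) \<le> c * n ^ c + c"
      unfolding b_def k_def D_def by (rule polynomial_bound_form) (simp_all add: c_def)
    obtain w L where L: "is_abp (b * (4 * k + 3)) w L" "abp_eval (b * (4 * k + 3)) w L = (hard_poly b k D :: 'a mpoly)"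
      "abp_size (b * (4 * k + 3)) w \<le> (b * (4 * k + 3) + 1) * (k * D)"
      using width_computable_abp[OF width_computable_hard_poly[OF k D]] k D by auto
    have "(b * (4 * k + 3) + 1) * (k * D) \<le> (b * (8 * k)) * (k * D)"
    proof (rule mult_right_mono)
      have "b * (4 * k + 3) + 1 \<le> b * (4 * k + 3) + b" using b by simp
      also have "\<dots> = b * (4 * k + 4)" by (simp add: algebra_simps)
      also have "\<dots> \<le> b * (8 * k)" using k by simp
      finally show "b * (4 * k + 3) + 1 \<le> b * (8 * k)" .
    qed simp
    also have "\<dots> = 2048 * (b ^ 3 * D)" by (simp add: k_def power3_eq_cube)
    also have "\<dots> \<le> 2048 * (32768 ^ 3 * 2 * (n + 1) ^ 7)" by (rule mult_left_mono[OF b3]) simp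
    also have "\<dots> = C * (n + 1) ^ 7" by (simp add: C_def)
    finally have "abp_size (b * (4 * k + 3)) w \<le> C * (n + 1) ^ 7" using L(3) by linarith
    then have "abp_size (b * (4 * k + 3)) w \<le> c * n ^ c + c"
      by (rule polynomial_bound_form) (simp_all add: c_def)
    then show "\<exists>d w L. is_abp d w L \<and> abp_eval d w L = (hard_poly (hard_b n) (16 * hard_b n) (n + 2) :: 'a mpoly) \<and> abp_size d w \<le> c * n ^ c + c"
      using L(1,2) unfolding b_def k_def D_def by blast
  qed
qed

theorem theorem1p5:
  shows "\<exists>\<delta>::real. \<delta> \<ge> 1/100 \<and>
    (\<exists>(G :: nat \<Rightarrow> 'a::field mpoly) (m :: nat \<Rightarrow> nat) (X :: nat \<Rightarrow> nat \<Rightarrow> nat set).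
       in_VBP G \<and>
       (\<forall>n. is_var_partition (m n) (X n) \<and> set_multilinear (m n) (X n) (G n)) \<and>
       (\<exists>c1 c2 N. c1 > (0::real) \<and> (\<forall>n\<ge>N.
          c1 * real n ^ 2 \<le> real (card (vars (G n))) \<and> real (card (vars (G n))) \<le> c2 * real n ^ 2 \<and>
          c1 * real n \<le> real (total_degree (G n)) \<and> real (total_degree (G n)) \<le> c2 * real n)) \<and>
       (\<exists>\<epsilon>>0. \<exists>N. \<forall>n\<ge>N. \<forall>As. sum_smabp_computes (m n) (X n) As (G n) \<longrightarrow>
          exp (\<epsilon> * real n powr \<delta>) \<le> real (total_width (m n) As)))"
proof -
  \<comment> \<open>The number of colours n + 2 is at least 2, as the identity matrix requires, and
    raises the number of variables from order b^2, that is n, to order n^2.\<close>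
  define G :: "nat \<Rightarrow> 'a mpoly" where "G n = hard_poly (hard_b n) (16 * hard_b n) (n + 2)" for n
  define X where "X n = buckets (hard_b n) (16 * hard_b n) (n + 2)" for n
  define m where "m n = 2 * (hard_b n * (16 * hard_b n)) + hard_b n" for n
  have vbp: "in_VBP G" using hard_poly_in_VBP unfolding G_def .
  have sml: "is_var_partition (m n) (X n) \<and> set_multilinear (m n) (X n) (G n)" for n
    unfolding m_def X_def G_def by (intro conjI buckets_var_partition set_multilinear_hard_poly)
  have size: "1 * real n ^ 2 \<le> real (card (vars (G n))) \<and> real (card (vars (G n))) \<le> 2 ^ 41 * real n ^ 2 \<and>
      1 * real n \<le> real (total_degree (G n)) \<and> real (total_degree (G n)) \<le> 2 ^ 41 * real n"
    if n: "n \<ge> 1" for n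
  proof -
    let ?b = "hard_b n"
    note bb = hard_b_sq_bounds[OF n]
    have k: "16 * ?b > 0" using hard_b_pos by simp
    have "real (?b * (16 * ?b) * 2 * (n + 2)) \<le> real (card (vars (G n)))"
      unfolding G_def of_nat_le_iff using card_vars_hard_poly(1)[OF k, of ?b "n + 2", where 'a = 'a] by (simp add: mult_ac)
    moreover have "real (?b * (16 * ?b) * 2 * (n + 2)) = 32 * (real ?b)\<^sup>2 * (real n + 2)"
      by (simp add: power2_eq_square algebra_simps)
    moreover have "real n * real n \<le> (32 * (real ?b)\<^sup>2) * (real n + 2)"
    proof (rule mult_mono)
      show "real n \<le> 32 * (real ?b)\<^sup>2" using bb(1) zero_le_power2[of "real ?b"] by linarith
    qed auto
    ultimately have 1: "real n ^ 2 \<le> real (card (vars (G n)))" by (simp add: power2_eq_square)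
    have "real (card (vars (G n))) \<le> real (2 * (?b * (16 * ?b)) * (n + 2) + ?b * (16 * ?b))"
      unfolding G_def of_nat_le_iff by (rule card_vars_hard_poly(2)[OF k])
    also have "\<dots> = (real ?b)\<^sup>2 * (32 * real n + 80)" by (simp add: power2_eq_square algebra_simps)
    \<comment> \<open>For n >= 1 one has 32 n + 80 <= 112 n, and 112 < 2^7 explains the final
      2^41.\<close>
    also have "\<dots> \<le> (2 ^ 34 * real n) * (112 * real n)"
      using bb(2) n by (intro mult_mono) auto
    also have "\<dots> \<le> 2 ^ 41 * real n ^ 2" by (simp add: power2_eq_square)
    finally have 2: "real (card (vars (G n))) \<le> 2 ^ 41 * real n ^ 2" .
    have "total_degree (G n) = 2 * (?b * (16 * ?b)) + ?b"
      unfolding G_def by (rule total_degree_hard_poly[OF k]) simp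
    then have deg: "real (total_degree (G n)) = 32 * (real ?b)\<^sup>2 + real ?b" by (simp add: power2_eq_square)
    have "real ?b \<le> (real ?b)\<^sup>2" using hard_b_pos[of n] by (simp add: power2_eq_square)
    moreover have "33 * (2 ^ 34 * real n) \<le> 2 ^ 41 * real n" by simp
    ultimately have "real n \<le> real (total_degree (G n))" "real (total_degree (G n)) \<le> 2 ^ 41 * real n"
      using bb deg by linarith+
    then show ?thesis using 1 2 by simp
  qed
  have width: "exp (ln 2 / 66 * real n powr (1/4)) \<le> real (total_width (m n) As)"
    if comp: "sum_smabp_computes (m n) (X n) As (G n)" for n As
  proof -
    have h: "hard_h n > 0" by (simp add: hard_h_def)
    have "2 ^ hard_h n \<le> total_width (m n) As ^ 66"
      using total_width_lower_bound[OF h hard_b_def refl, of "n + 2" "m n" As] comp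
      by (simp add: m_def X_def G_def)
    then have le: "real (2 ^ hard_h n) \<le> real (total_width (m n) As ^ 66)" by (simp only: of_nat_le_iff)
    have "exp (ln 2 / 66 * real n powr (1/4)) ^ 66 = exp (ln 2 * real n powr (1/4))"
      by (simp flip: exp_of_nat_mult)
    also have "\<dots> \<le> exp (ln 2 * real (hard_h n))"
      using hard_h_bounds(1) by simp
    also have "\<dots> = 2 ^ hard_h n" by (simp add: exp_of_nat_mult mult.commute)
    also have "\<dots> \<le> real (total_width (m n) As) ^ 66" using le by simp
    finally have "exp (ln 2 / 66 * real n powr (1/4)) ^ 66 \<le> real (total_width (m n) As) ^ 66" .
    then show ?thesis by (rule power_le_imp_le_base[where n = 65, unfolded One_nat_def, simplified]) simp
  qed
  have asymp: "\<exists>c1 c2 N. c1 > (0::real) \<and> (\<forall>n\<ge>N.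
      c1 * real n ^ 2 \<le> real (card (vars (G n))) \<and> real (card (vars (G n))) \<le> c2 * real n ^ 2 \<and>
      c1 * real n \<le> real (total_degree (G n)) \<and> real (total_degree (G n)) \<le> c2 * real n)"
    by (rule exI[of _ 1], rule exI[of _ "2 ^ 41"], rule exI[of _ 1], intro conjI zero_less_one allI impI size)
  have lower: "\<exists>\<epsilon>>0. \<exists>N. \<forall>n\<ge>N. \<forall>As. sum_smabp_computes (m n) (X n) As (G n) \<longrightarrow>
      exp (\<epsilon> * real n powr (1/4)) \<le> real (total_width (m n) As)"
    by (rule exI[of _ "ln 2 / 66"], intro conjI exI[of _ 0] allI impI width) simp
  show ?thesis
  proof (rule exI[of _ "1/4"], rule conjI)
    show "1 / 100 \<le> (1 / 4 :: real)" by simp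
  qed (rule exI[of _ G], rule exI[of _ m], rule exI[of _ X], intro conjI vbp asymp lower, use sml in blast)
qed

end
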